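(* Let $\lambda/\mu$ be a connected skew shape and let $(\theta_1,\ldots,\theta_k)$ be its Lascoux--Pragacz decomposition. Then \[ e(\lambda/\mu) = \det \big[\, e(\theta_i \# \theta_j)\, \big]_{i,j=1}^k, \] with the conventions $e(\varnothing)=1$ and $e(\phi[p,q])=0$ when $\phi[p,q]$ is undefined.
   Context: Young diagrams use matrix coordinates: $[\lambda]=\{(i,j):1\le i,\ 1\le j\le\lambda_i\}$; the content of cell $(i,j)$ is $j-i$. Excited diagrams: for $D\subseteq[\lambda]$, a cell $(i,j)\in D$ is active if $(i+1,j),(i,j+1),(i+1,j+1)$ all lie in $[\lambda]\setminus D$; an excited move replaces an active cell $(i,j)$ by $(i+1,j+1)$. The excited diagrams of $\lambda/\mu$ are the subsets of $[\lambda]$ obtainable from $[\mu]$ by a sequence of excited moves; $e(\lambda/\mu)$ is their number. A border strip is a connected skew shape containing no $2\times2$ square; its starting point is its southwest-most cell and its ending point its northeast-most cell, and $p(\theta)$, $q(\theta)$ denote the contents of the starting and ending points of $\theta$. For a border strip $\theta$ (a set of cells), $e(\theta)$ means $e(\alpha/\beta)$ where, after translating $\theta$ so that its topmost row is row 1 and its leftmost column is column 1, $\alpha$ is the smallest partition with $[\alpha]$ containing $\theta$ and $[\beta]=[\alpha]\setminus\theta$. The outer border strip of a partition $\nu$ is the set of cells $(i,j)\in[\nu]$ with $(i+1,j+1)\notin[\nu]$. Lascoux--Pragacz decomposition: set $\lambda^{(0)}=\lambda$; for $t\ge1$ let $\beta_t$ be the outer border strip of $\lambda^{(t-1)}$ and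 $[\lambda^{(t)}]=[\lambda^{(t-1)}]\setminus\beta_t$; the strips $\theta_1,\dots,\theta_k$ are the connected components of the sets $\beta_t\setminus[\mu]$, $t=1,2,\dots$ (nonempty ones), indexed in decreasing order of the content of their ending points, so that $\theta_1$ is the strip coming from the outer border strip of $\lambda$; $\tau:=\theta_1$ is the cutting strip. For integers $p,q$, $\phi[p,q]$ is the substrip of $\tau$ consisting of its cells with content between $p$ and $q$; by convention $\phi[p+1,p]=\varnothing$ and $\phi[p,q]$ is undefined if $p>q+1$. Finally $\theta_i\#\theta_j:=\phi[p(\theta_j),q(\theta_i)]$. *)

theory Defs
  imports "Jordan_Normal_Form.Determinant"
begin

type_synonym cell = "nat \<times> nat"

definition is_partition :: "nat list \<Rightarrow> bool" where
  "is_partition lam \<longleftrightarrow> sorted_wrt (\<ge>) lam \<and> (\<forall>x\<in>set lam. 0 < x)"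

text \<open>Cells are numbered from 1, whereas list positions are numbered from 0.\<close>

definition diagram :: "nat list \<Rightarrow> cell set" where
  "diagram lam = {(i, j). 1 \<le> i \<and> i \<le> length lam \<and> 1 \<le> j \<and> j \<le> lam ! (i - 1)}"

definition content :: "cell \<Rightarrow> int" where
  "content c = int (snd c) - int (fst c)"

definition active :: "cell set \<Rightarrow> cell set \<Rightarrow> nat \<Rightarrow> nat \<Rightarrow> bool" where
  "active L D i j \<longleftrightarrow>
     (i, j) \<in> D \<and> {(i + 1, j), (i, j + 1), (i + 1, j + 1)} \<subseteq> L - D"

inductive_set excited_diagrams :: "nat list \<Rightarrow> nat list \<Rightarrow> cell set set"
  for lam mu :: "nat list" where
  start: "diagram mu \<in> excited_diagrams lam mu"
| move: "D \<in> excited_diagrams lam mu \<Longrightarrow> active (diagram lam) D i j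
    \<Longrightarrow> insert (i + 1, j + 1) (D - {(i, j)}) \<in> excited_diagrams lam mu"

definition num_excited :: "nat list \<Rightarrow> nat list \<Rightarrow> nat" where
  "num_excited lam mu = card (excited_diagrams lam mu)"

definition adjacent :: "cell \<Rightarrow> cell \<Rightarrow> bool" where
  "adjacent c d \<longleftrightarrow>
     \<bar>int (fst c) - int (fst d)\<bar> + \<bar>int (snd c) - int (snd d)\<bar> = 1"

definition linked :: "cell set \<Rightarrow> (cell \<times> cell) set" where
  "linked S = {(c, d). c \<in> S \<and> d \<in> S \<and> adjacent c d}\<^sup>*"

definition cells_connected :: "cell set \<Rightarrow> bool" where
  "cells_connected S \<longleftrightarrow> (\<forall>c\<in>S. \<forall>d\<in>S. (c, d) \<in> linked S)"

definition components :: "cell set \<Rightarrow> cell set set" where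
  "components S = S // linked S"

text \<open>The starting and ending points are meant for nonempty border strips, which have a
  unique southwest-most and a unique northeast-most cell; rows are numbered downwards.\<close>

definition starting_point :: "cell set \<Rightarrow> cell" where
  "starting_point \<theta> = (THE c. c \<in> \<theta> \<and> (\<forall>d\<in>\<theta>. fst d \<le> fst c \<and> snd c \<le> snd d))"

definition ending_point :: "cell set \<Rightarrow> cell" where
  "ending_point \<theta> = (THE c. c \<in> \<theta> \<and> (\<forall>d\<in>\<theta>. fst c \<le> fst d \<and> snd d \<le> snd c))"

definition start_content :: "cell set \<Rightarrow> int" where
  "start_content \<theta> = content (starting_point \<theta>)"

definition end_content :: "cell set \<Rightarrow> int" where
  "end_content \<theta> = content (ending_point \<theta>)"

definition normalize_cells :: "cell set \<Rightarrow> cell set" where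
  "normalize_cells \<theta> =
     (\<lambda>(i, j). (i + 1 - Min (fst ` \<theta>), j + 1 - Min (snd ` \<theta>))) ` \<theta>"

definition smallest_partition :: "cell set \<Rightarrow> nat list" where
  "smallest_partition S =
     (THE \<alpha>. is_partition \<alpha> \<and> S \<subseteq> diagram \<alpha> \<and>
        (\<forall>\<gamma>. is_partition \<gamma> \<and> S \<subseteq> diagram \<gamma> \<longrightarrow> diagram \<alpha> \<subseteq> diagram \<gamma>))"

definition strip_excited :: "cell set \<Rightarrow> nat" where
  "strip_excited \<theta> =
     (if \<theta> = {} then 1
      else let \<alpha> = smallest_partition (normalize_cells \<theta>);
               \<beta> = (THE \<beta>. is_partition \<beta> \<and> diagram \<beta> = diagram \<alpha> - normalize_cells \<theta>)
           in num_excited \<alpha> \<beta>)"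

definition outer_strip :: "cell set \<Rightarrow> cell set" where
  "outer_strip N = {(i, j). (i, j) \<in> N \<and> (i + 1, j + 1) \<notin> N}"

text \<open>\<^term>\<open>peeled lam t\<close> is the diagram left after removing the first \<^term>\<open>t\<close> outer border strips.\<close>

fun peeled :: "nat list \<Rightarrow> nat \<Rightarrow> cell set" where
  "peeled lam 0 = diagram lam"
| "peeled lam (Suc t) = peeled lam t - outer_strip (peeled lam t)"

definition lascoux_pragacz :: "nat list \<Rightarrow> nat list \<Rightarrow> cell set list \<Rightarrow> bool" where
  "lascoux_pragacz lam mu \<theta>s \<longleftrightarrow>
     set \<theta>s = (\<Union>t. components (outer_strip (peeled lam t) - diagram mu)) \<and>
     distinct \<theta>s \<and> sorted_wrt (\<lambda>\<theta> \<theta>'. end_content \<theta> \<ge> end_content \<theta>') \<theta>s"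

text \<open>\<^const>\<open>None\<close> stands for an undefined substrip.\<close>

definition substrip :: "cell set \<Rightarrow> int \<Rightarrow> int \<Rightarrow> cell set option" where
  "substrip \<tau> p q =
     (if p > q + 1 then None else Some {c \<in> \<tau>. p \<le> content c \<and> content c \<le> q})"

definition hash_strip :: "cell set \<Rightarrow> cell set \<Rightarrow> cell set \<Rightarrow> cell set option" where
  "hash_strip \<tau> \<theta> \<theta>' = substrip \<tau> (start_content \<theta>') (end_content \<theta>)"

definition substrip_excited :: "cell set option \<Rightarrow> nat" where
  "substrip_excited s = (case s of None \<Rightarrow> 0 | Some \<theta> \<Rightarrow> strip_excited \<theta>)"

end

theory Submission
  imports Defs
begin

text \<open>
  Encode a Young diagram by its Maya diagram. Adding a corner of content \<open>k\<close> to \<open>\<lambda>\<close> changes the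
  vector of all numbers \<open>e(\<lambda>/\<mu>)\<close>, indexed by \<open>\<mu>\<close>, by the operator that moves a particle from
  position \<open>k - 1\<close> to position \<open>k\<close>; on maximal minors this is the addition of column \<open>k - 1\<close> to
  column \<open>k\<close>. Hence the numbers \<open>e(\<lambda>/\<mu>)\<close> are the maximal minors of one matrix. The minor
  belonging to \<open>\<mu> = \<lambda>\<close> is \<open>1\<close>, so by Cramer's rule every minor is a determinant of minors that
  differ from it in a single column, that is, of numbers \<open>e(\<lambda>/\<nu>)\<close> where \<open>\<lambda>/\<nu>\<close> is a border
  strip. The columns to be exchanged are the starting and ending contents of the Lascoux--Pragacz
  strips, which are the maximal intervals of the superlevel sets of the number of cells of \<open>\<lambda>/\<mu>\<close>
  on a diagonal; as these intervals do not cross, all signs cancel.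
\<close>

section \<open>Young diagrams and Maya diagrams\<close>

text \<open>The column operation rests on a recursion. When a corner \<open>x\<close> of content
  \<open>k\<close> is added to \<lambda>, the excited diagrams avoiding \<open>x\<close> are those
  of the smaller shape. Those containing \<open>x\<close> arise by pushing a cell of \<mu> along its
  diagonal to \<open>x\<close>, which requires a removable corner of \<mu> with content
  \<open>k\<close>; deleting that corner moves a particle of \<mu> from \<open>k\<close> to
  \<open>k - 1\<close>. Maya diagrams are infinite, so all positions below a bound
  \<open>- n\<close> are cut off; exactly \<open>n\<close> particles remain. Columns are listed by
  arbitrary injections \<open>f\<close>, with a sign \<open>inv_sign\<close> recording the order, so
  that exchanging one column leaves the others in place. Removing a border strip with contents from
  \<open>c + 1\<close> to \<open>r\<close> moves one particle from \<open>r\<close> to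
  \<open>c\<close>. The exchange for the strips \<open>i\<close> and \<open>j\<close> therefore
  replaces the ending content of \<open>i\<close> by the starting content of \<open>j\<close> minus
  1. If the new position is the larger one, the resulting diagram strictly contains \<lambda> and
  its minor is 0, as the convention for undefined substrips demands. Connectedness ensures that the
  cutting strip covers all contents in between.\<close>

definition young :: "cell set \<Rightarrow> bool" where
  "young L \<longleftrightarrow> finite L \<and> (\<forall>i j. (i, j) \<in> L \<longrightarrow> 1 \<le> i \<and> 1 \<le> j) \<and>
     (\<forall>i j i' j'. (i, j) \<in> L \<longrightarrow> 1 \<le> i' \<longrightarrow> i' \<le> i \<longrightarrow> 1 \<le> j' \<longrightarrow> j' \<le> j \<longrightarrow> (i', j') \<in> L)"

lemma young_finite: "young L \<Longrightarrow> finite L"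
  by (simp add: young_def)

lemma young_pos: "young L \<Longrightarrow> (i, j) \<in> L \<Longrightarrow> 1 \<le> i \<and> 1 \<le> j"
  unfolding young_def by blast

lemma young_down:
  "young L \<Longrightarrow> (i, j) \<in> L \<Longrightarrow> 1 \<le> i' \<Longrightarrow> i' \<le> i \<Longrightarrow> 1 \<le> j' \<Longrightarrow> j' \<le> j \<Longrightarrow> (i', j') \<in> L"
  unfolding young_def by blast

lemma young_empty: "young {}"
  by (simp add: young_def)

lemma young_insertI:
  assumes L: "young L" and pos: "1 \<le> i" "1 \<le> j"
    and up: "i = 1 \<or> (i - 1, j) \<in> L" and left: "j = 1 \<or> (i, j - 1) \<in> L"
  shows "young (insert (i, j) L)"
proof -
  have "(a', b') \<in> insert (i, j) L"
    if ab: "(a, b) \<in> insert (i, j) L" "1 \<le> a'" "a' \<le> a" "1 \<le> b'" "b' \<le> b" for a b a' b'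
  proof (cases "(a, b) \<in> L \<or> (a', b') = (i, j)")
    case True
    then show ?thesis using young_down[OF L] ab by blast
  next
    case False
    then have [simp]: "a = i" "b = j" using ab by auto
    from False ab have "a' \<le> i - 1 \<and> b' \<le> j \<and> i \<noteq> 1 \<or> a' \<le> i \<and> b' \<le> j - 1 \<and> j \<noteq> 1"
      by auto
    then show ?thesis using up left ab young_down[OF L] by blast
  qed
  then show ?thesis using L pos unfolding young_def by blast
qed

lemma young_removeI:
  assumes L: "young L" and "(Suc i, j) \<notin> L" "(i, Suc j) \<notin> L"
  shows "young (L - {(i, j)})"
proof -
  have "(a', b') \<in> L - {(i, j)}"
    if ab: "(a, b) \<in> L - {(i, j)}" "1 \<le> a'" "a' \<le> a" "1 \<le> b'" "b' \<le> b" for a b a' b'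
  proof -
    have "(a', b') \<in> L" using young_down[OF L] ab by blast
    moreover have "(a', b') \<noteq> (i, j)"
    proof
      assume "(a', b') = (i, j)"
      have "i \<le> a" "j \<le> b" "a \<noteq> i \<or> b \<noteq> j" using ab \<open>(a', b') = (i, j)\<close> by auto
      then have "Suc i \<le> a \<or> Suc j \<le> b" by linarith
      then show False using young_down[OF L, of a b "Suc i" j] young_down[OF L, of a b i "Suc j"] ab assms
          \<open>(a', b') = (i, j)\<close> \<open>i \<le> a\<close> \<open>j \<le> b\<close> by auto
    qed
    ultimately show ?thesis by simp
  qed
  moreover have "finite (L - {(i, j)})" using L by (simp add: young_def)
  moreover have "\<forall>a b. (a, b) \<in> L - {(i, j)} \<longrightarrow> 1 \<le> a \<and> 1 \<le> b"
    using young_pos[OF L] by blast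
  ultimately show ?thesis unfolding young_def by blast
qed

lemma young_corner_exists:
  assumes L: "young L" and "L \<noteq> {}"
  obtains i j where "(i, j) \<in> L" "(Suc i, j) \<notin> L" "(i, Suc j) \<notin> L"
proof -
  let ?S = "(\<lambda>c. fst c + snd c) ` L"
  have fin: "finite ?S" and "?S \<noteq> {}" using young_finite[OF L] \<open>L \<noteq> {}\<close> by auto
  then have "Max ?S \<in> ?S" by (rule Max_in)
  then obtain i j where ij: "(i, j) \<in> L" "Max ?S = i + j" by auto
  have mx: "fst c + snd c \<le> i + j" if "c \<in> L" for c
    using Max_ge[OF fin, of "fst c + snd c"] that ij by auto
  have "(Suc i, j) \<notin> L" "(i, Suc j) \<notin> L"
    using mx[of "(Suc i, j)"] mx[of "(i, Suc j)"] by auto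
  then show ?thesis using that ij(1) by blast
qed

text \<open>Adding one cell at a time matches both the hop of one particle in the Maya diagram and
  the corner recursion for excited diagrams.\<close>

lemma young_induct [consumes 1, case_names empty insert]:
  assumes "young L" and "P {}"
    and step: "\<And>i j L. young L \<Longrightarrow> (i, j) \<notin> L \<Longrightarrow> young (insert (i, j) L) \<Longrightarrow> P L \<Longrightarrow> P (insert (i, j) L)"
  shows "P L"
  using \<open>young L\<close>
proof (induction "card L" arbitrary: L)
  case 0
  then show ?case using \<open>P {}\<close> young_finite by auto
next
  case (Suc m)
  then have "L \<noteq> {}" by auto
  then obtain i j where ij: "(i, j) \<in> L" "(Suc i, j) \<notin> L" "(i, Suc j) \<notin> L"
    using young_corner_exists Suc.prems by blast
  have y: "young (L - {(i, j)})" using young_removeI Suc.prems ij by blast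
  have "P (L - {(i, j)})" by (rule Suc.hyps(1)) (use Suc ij y young_finite in auto)
  then have "P (insert (i, j) (L - {(i, j)}))"
    by (intro step) (use y ij Suc.prems in \<open>auto simp: insert_absorb\<close>)
  then show ?case using ij by (simp add: insert_absorb)
qed

text \<open>Since \<open>nat\<close> sends negative integers to 0, the cell with
  \<open>s = 1\<close> lies in row 1 or column 1, and \<open>s\<close> counts along the diagonal of
  content \<open>k\<close> from 1. An excited move is a step from \<open>s\<close> to
  \<open>s + 1\<close>.\<close>

definition diag_cell :: "int \<Rightarrow> nat \<Rightarrow> cell" where
  "diag_cell k s = (s + nat (- k), s + nat k)"

definition diag_len :: "cell set \<Rightarrow> int \<Rightarrow> nat" where
  "diag_len L k = card {c \<in> L. content c = k}"

lemma content_diag_cell [simp]: "content (diag_cell k s) = k"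
  by (auto simp: content_def diag_cell_def)

lemma diag_cell_inject [simp]: "diag_cell k s = diag_cell k' s' \<longleftrightarrow> k = k' \<and> s = s'"
proof
  assume a: "diag_cell k s = diag_cell k' s'"
  then have "k = k'" by (metis content_diag_cell)
  then show "k = k' \<and> s = s'" using a by (simp add: diag_cell_def)
qed auto

lemma diag_cell_content: "diag_cell (content (i, j)) (min i j) = (i, j)"
  by (auto simp: diag_cell_def content_def min_def)

lemma diag_cell_cases: obtains s where "c = diag_cell (content c) s"
  by (metis diag_cell_content surj_pair)

lemma initial_segment:
  fixes T :: "nat set"
  assumes fin: "finite T" and pos: "\<And>s. s \<in> T \<Longrightarrow> 1 \<le> s"
    and down: "\<And>s s'. s \<in> T \<Longrightarrow> 1 \<le> s' \<Longrightarrow> s' \<le> s \<Longrightarrow> s' \<in> T"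
  shows "T = {1..card T}"
proof (cases "T = {}")
  case False
  have T: "T = {1..Max T}"
  proof (intro equalityI subsetI)
    fix s assume "s \<in> T"
    then show "s \<in> {1..Max T}" using fin pos by simp
  next
    fix s assume "s \<in> {1..Max T}"
    then show "s \<in> T" using down[OF Max_in[OF fin False]] by simp
  qed
  have "card T = Max T" using arg_cong[OF T, of card] by simp
  then show ?thesis using T by metis
qed auto

lemma diag_cell_mem_iff:
  assumes L: "young L"
  shows "diag_cell k s \<in> L \<longleftrightarrow> 1 \<le> s \<and> s \<le> diag_len L k"
proof -
  define T where "T = {s. diag_cell k s \<in> L}"
  have eq: "{c \<in> L. content c = k} = diag_cell k ` T"
  proof (intro Set.set_eqI iffI)
    fix c assume "c \<in> {c \<in> L. content c = k}"
    then show "c \<in> diag_cell k ` T"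
      by (cases c rule: diag_cell_cases) (auto simp: T_def)
  qed (auto simp: T_def)
  have inj: "inj_on (diag_cell k) T" by (auto simp: inj_on_def)
  have "finite (diag_cell k ` T)" unfolding eq[symmetric] using young_finite[OF L] by simp
  then have fin: "finite T" using inj finite_imageD by blast
  have pos: "1 \<le> s" if "s \<in> T" for s
    using that young_pos[OF L, of "s + nat (- k)" "s + nat k"]
    by (cases "k \<ge> 0") (simp_all add: T_def diag_cell_def)
  have down: "s' \<in> T" if "s \<in> T" "1 \<le> s'" "s' \<le> s" for s s'
    using that young_down[OF L, of "s + nat (- k)" "s + nat k" "s' + nat (- k)" "s' + nat k"]
    by (auto simp: T_def diag_cell_def)
  have "T = {1..card T}" by (rule initial_segment) (fact fin pos down)+
  moreover have "card T = diag_len L k"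
    unfolding diag_len_def eq by (rule card_image[OF inj, symmetric])
  ultimately have "s \<in> T \<longleftrightarrow> 1 \<le> s \<and> s \<le> diag_len L k"
    by (metis atLeastAtMost_iff)
  then show ?thesis by (simp add: T_def)
qed

lemma young_mem_iff:
  assumes "young L"
  shows "(i, j) \<in> L \<longleftrightarrow> 1 \<le> i \<and> 1 \<le> j \<and> min i j \<le> diag_len L (int j - int i)"
  using diag_cell_mem_iff[OF assms, of "int j - int i" "min i j"] diag_cell_content[of i j]
  by (simp add: content_def)

lemma diag_len_mono: "young L \<Longrightarrow> M \<subseteq> L \<Longrightarrow> diag_len M k \<le> diag_len L k"
  unfolding diag_len_def by (intro card_mono) (auto dest: young_finite)

lemma young_subset_iff:
  assumes "young L" "young M"
  shows "M \<subseteq> L \<longleftrightarrow> (\<forall>k. diag_len M k \<le> diag_len L k)"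
proof
  assume "\<forall>k. diag_len M k \<le> diag_len L k"
  then show "M \<subseteq> L"
    by (auto simp: young_mem_iff[OF assms(1)] young_mem_iff[OF assms(2)] simp del: min_le_iff_disj)
      (meson order_trans)
qed (use diag_len_mono assms in blast)

text \<open>Cells with equal \<open>s\<close> on consecutive diagonals are vertical neighbours for
  \<open>k < 0\<close> and horizontal neighbours for \<open>k \<ge> 0\<close>; shifting one
  \<open>s\<close> by 1 gives the other kind of neighbour. Closure of \<open>L\<close> under going
  up and left then bounds the difference on both sides.\<close>

lemma diag_len_step:
  assumes L: "young L"
  shows "int (diag_len L (k + 1)) - int (diag_len L k) \<in> (if k < 0 then {0, 1} else {-1, 0})"
proof -
  note m = diag_cell_mem_iff[OF L]
  let ?a = "diag_len L k" and ?b = "diag_len L (k + 1)"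
  show ?thesis
  proof (cases "k < 0")
    case True
    have "?a \<le> ?b"
    proof (cases "?a = 0")
      case False
      then have "diag_cell k ?a \<in> L" using m by simp
      then have "diag_cell (k + 1) ?a \<in> L" 
        unfolding diag_cell_def using True False by (elim young_down[OF L]) auto
      then show ?thesis using m by simp
    qed simp
    moreover have "?b \<le> ?a + 1"
    proof (cases "?b \<le> 1")
      case False
      then have "diag_cell (k + 1) ?b \<in> L" using m by simp
      then have "diag_cell k (?b - 1) \<in> L" 
        unfolding diag_cell_def using True False
        by (elim young_down[OF L]) auto
      then show ?thesis unfolding m by linarith
    qed simp
    ultimately show ?thesis using True by auto
  next
    case False
    have "?b \<le> ?a"
    proof (cases "?b = 0")
      case b: False
      then have "diag_cell (k + 1) ?b \<in> L" using m by simp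
      then have "diag_cell k ?b \<in> L" 
        unfolding diag_cell_def using False b
        by (elim young_down[OF L]) auto
      then show ?thesis unfolding m by linarith
    qed simp
    moreover have "?a \<le> ?b + 1"
    proof (cases "?a \<le> 1")
      case a: False
      then have "diag_cell k ?a \<in> L" using m by simp
      then have "diag_cell (k + 1) (?a - 1) \<in> L" 
        unfolding diag_cell_def using False a
        by (elim young_down[OF L]) auto
      then show ?thesis unfolding m by linarith
    qed simp
    ultimately show ?thesis using False by auto
  qed
qed

text \<open>For the diagram of a partition \<open>\<lambda>\<close> this is the Maya diagram \<open>{\<lambda>\<^sub>i - i | i \<ge> 1}\<close>,
  the set of contents after which the boundary of \<open>\<lambda>\<close> makes a vertical step.\<close>

definition maya :: "cell set \<Rightarrow> int set" where
  "maya L = {k. int (diag_len L (k + 1)) - int (diag_len L k) = (if k < 0 then 0 else - 1)}"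

lemma diag_len_Suc:
  assumes "young L"
  shows "int (diag_len L (k + 1)) =
    int (diag_len L k) + (if k < 0 then 1 else 0) - (if k \<in> maya L then 1 else 0)"
  using diag_len_step[OF assms, of k] by (cases "k < 0") (auto simp: maya_def)

lemma diag_len_pred:
  assumes "young L"
  shows "int (diag_len L k) =
    int (diag_len L (k - 1)) + (if k \<le> 0 then 1 else 0) - (if k - 1 \<in> maya L then 1 else 0)"
  using diag_len_Suc[OF assms, of "k - 1"] by simp

lemma diag_len_eventually_0:
  assumes "finite L"
  obtains N where "\<And>k. N \<le> \<bar>k\<bar> \<Longrightarrow> diag_len L k = 0" "0 \<le> N"
proof -
  let ?S = "insert 0 ((\<lambda>c. \<bar>content c\<bar>) ` L)"
  have f: "finite ?S" using assms by simp
  have *: "\<bar>content c\<bar> < Max ?S + 1" if "c \<in> L" for c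
    using Max_ge[OF f, of "\<bar>content c\<bar>"] that by (simp add: le_imp_less_Suc)
  have "diag_len L k = 0" if k: "Max ?S + 1 \<le> \<bar>k\<bar>" for k
  proof -
    have False if "c \<in> L" "content c = k" for c
      using *[OF that(1)] that(2) k by linarith
    then have "{c \<in> L. content c = k} = {}" by blast
    then show ?thesis unfolding diag_len_def by (simp only: card.empty)
  qed
  moreover have "0 \<le> Max ?S + 1" using Max_ge[OF f, of 0] by simp
  ultimately show ?thesis using that by blast
qed

text \<open>Discrete integration: the Maya diagrams give the increments of the diagonal lengths, the
  dependence on the sign of \<open>k\<close> cancels in the difference, and vanishing far to the
  left fixes the constant.\<close>

lemma diag_len_diff:
  assumes "young L" "young M"
    and eq: "\<And>k. (if k \<in> maya M then 1 else 0) - (if k \<in> maya L then 1 else (0::int)) = g (k + 1) - g k"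
    and g: "\<And>k. k \<le> K \<Longrightarrow> g k = 0"
  shows "int (diag_len L k) - int (diag_len M k) = g k"
proof -
  obtain N N' where N: "\<And>k. N \<le> \<bar>k\<bar> \<Longrightarrow> diag_len L k = 0" and N': "\<And>k. N' \<le> \<bar>k\<bar> \<Longrightarrow> diag_len M k = 0"
    using diag_len_eventually_0 young_finite assms(1,2) by metis
  \<comment> \<open>A starting point at which both diagonal lengths and \<open>g\<close> vanish, and
    from which \<open>k\<close> is reached by upward induction.\<close>
  define b where "b = min (min K (- \<bar>N\<bar>)) (min (- \<bar>N'\<bar>) k)"
  have "b \<le> k" "b \<le> K" "N \<le> \<bar>b\<bar>" "N' \<le> \<bar>b\<bar>" by (auto simp: b_def)
  from \<open>b \<le> k\<close> show ?thesis
  proof (induction k rule: int_ge_induct)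
    case base
    then show ?case using N[OF \<open>N \<le> \<bar>b\<bar>\<close>] N'[OF \<open>N' \<le> \<bar>b\<bar>\<close>] g[OF \<open>b \<le> K\<close>] by simp
  next
    case (step k)
    then show ?case using diag_len_Suc[OF assms(1), of k] diag_len_Suc[OF assms(2), of k] eq[of k]
      by linarith
  qed
qed

lemma maya_inject:
  assumes "young L" "young M" "maya L = maya M"
  shows "L = M"
proof -
  have "int (diag_len L k) - int (diag_len M k) = 0" for k
    by (rule diag_len_diff[OF assms(1,2), of "\<lambda>_. 0" 0]) (use assms(3) in auto)
  then show ?thesis using young_subset_iff assms by (simp add: subset_antisym)
qed

section \<open>Corners as hops of a particle to a neighbouring position\<close>

lemma diag_len_insert:
  assumes "finite L" "x \<notin> L"
  shows "diag_len (insert x L) k = diag_len L k + (if k = content x then 1 else 0)"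
proof -
  have "{c \<in> insert x L. content c = k} =
      (if k = content x then insert x {c \<in> L. content c = k} else {c \<in> L. content c = k})"
    by auto
  then show ?thesis using assms by (simp add: diag_len_def)
qed

text \<open>One diagonal length grows by 1, so only the increments into and out of this diagonal
  change. The increment from \<open>k\<close> to \<open>k + 1\<close> is labelled by
  \<open>k\<close>, hence the positions \<open>content x - 1\<close> and
  \<open>content x\<close>.\<close>

lemma maya_insert:
  assumes L: "young L" and x: "x \<notin> L" and L': "young (insert x L)"
  shows "maya (insert x L) = insert (content x) (maya L - {content x - 1})"
    and "content x - 1 \<in> maya L" and "content x \<notin> maya L"
proof -
  let ?k = "content x"
  note d = diag_len_insert[OF young_finite[OF L] x]
  have *: "(if k \<in> maya (insert x L) then 1 else 0) - (if k \<in> maya L then 1 else (0::int))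
     = (if k = ?k then 1 else 0) - (if k = ?k - 1 then 1 else 0)" for k
  proof -
    have "k + 1 = ?k \<longleftrightarrow> k = ?k - 1" by linarith
    then show ?thesis using diag_len_Suc[OF L, of k] diag_len_Suc[OF L', of k] d[of k] d[of "k + 1"]
      by (simp split: if_splits)
  qed
  show "?k - 1 \<in> maya L" "?k \<notin> maya L" using *[of "?k - 1"] *[of ?k] by (auto split: if_splits)
  show "maya (insert x L) = insert ?k (maya L - {?k - 1})"
  proof (rule Set.set_eqI)
    fix k show "k \<in> maya (insert x L) \<longleftrightarrow> k \<in> insert ?k (maya L - {?k - 1})"
      using *[of k] by (auto split: if_splits)
  qed
qed

lemma maya_remove:
  assumes L: "young L" and x: "x \<in> L" and L': "young (L - {x})"
  shows "maya (L - {x}) = insert (content x - 1) (maya L - {content x})"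
    and "content x - 1 \<notin> maya L" and "content x \<in> maya L"
  using maya_insert[OF L', of x] x L by (auto simp: insert_absorb)

lemma maya_empty: "maya {} = {..<0}"
  by (auto simp: maya_def diag_len_def)

text \<open>The corner is the first free cell of the diagonal: a particle at \<open>k - 1\<close>
  and a hole at \<open>k\<close> force its left and upper neighbours into \<open>L\<close>, as far
  as they exist.\<close>

lemma addable_corner:
  assumes L: "young L" and k: "k - 1 \<in> maya L" "k \<notin> maya L"
  obtains x where "x \<notin> L" "content x = k" "young (insert x L)"
proof -
  define s where "s = Suc (diag_len L k)"
  let ?x = "diag_cell k s"
  have n: "?x \<notin> L" using diag_cell_mem_iff[OF L, of k s] by (simp add: s_def)
  have l: "int (diag_len L k) = int (diag_len L (k - 1)) - (if k \<le> 0 then 0 else 1)"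
    using diag_len_pred[OF L, of k] k by auto
  have r: "int (diag_len L (k + 1)) = int (diag_len L k) + (if k < 0 then 1 else 0)"
    using diag_len_Suc[OF L, of k] k by auto
  have "young (insert (s + nat (- k), s + nat k) L)"
    using l r by (intro young_insertI[OF L])
       (auto simp: s_def young_mem_iff[OF L] min_def add.commute[of 1 k] split: if_splits)
  then show ?thesis using that n by (simp add: diag_cell_def content_def)
qed

lemma removable_corner:
  assumes L: "young L" and k: "k - 1 \<notin> maya L" "k \<in> maya L"
  obtains x where "x \<in> L" "content x = k" "young (L - {x})"
proof -
  define s where "s = diag_len L k"
  let ?x = "diag_cell k s"
  have l: "int (diag_len L k) = int (diag_len L (k - 1)) + (if k \<le> 0 then 1 else 0)"
    using diag_len_pred[OF L, of k] k by auto
  have r: "int (diag_len L (k + 1)) = int (diag_len L k) + (if k < 0 then 1 else 0) - 1"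
    using diag_len_Suc[OF L, of k] k by auto
  have "1 \<le> s" using l r by (auto simp: s_def split: if_splits)
  then have n: "?x \<in> L" using diag_cell_mem_iff[OF L, of k s] by (simp add: s_def)
  have "young (L - {(s + nat (- k), s + nat k)})"
    using l r by (intro young_removeI[OF L])
       (auto simp: s_def young_mem_iff[OF L] min_def add.commute[of 1 k] split: if_splits)
  then show ?thesis using that n by (simp add: diag_cell_def content_def)
qed

text \<open>The particle may have to pass others, but particles are indistinguishable. If
  \<open>c - 1\<close> is occupied, its particle hops to \<open>c\<close> and the one from
  \<open>r\<close> fills \<open>c - 1\<close>; otherwise the one from \<open>r\<close> goes to
  \<open>c - 1\<close> first and then hops. Each hop adds a cell, whence the strict
  inclusion.\<close>

lemma maya_move_up:
  assumes "young L" "r \<in> maya L" "c \<notin> maya L" "r < c"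
  shows "\<exists>N. young N \<and> L \<subset> N \<and> maya N = insert c (maya L - {r})"
  using assms
proof (induction "nat (c - r)" arbitrary: L c)
  case (Suc m)
  show ?case
  proof (cases "c - 1 \<in> maya L")
    case True
    then obtain x where x: "x \<notin> L" "content x = c" "young (insert x L)"
      using addable_corner Suc.prems by metis
    note mx = maya_insert(1)[OF Suc.prems(1) x(1,3), unfolded x(2)]
    show ?thesis
    proof (cases "r = c - 1")
      case True
      then show ?thesis using x mx by blast
    next
      case False
      have "\<exists>N. young N \<and> insert x L \<subset> N \<and> maya N = insert (c - 1) (maya (insert x L) - {r})"
        by (rule Suc.hyps(1)) (use Suc.hyps(2) Suc.prems False x mx in auto)
      moreover have "insert (c - 1) (maya (insert x L) - {r}) = insert c (maya L - {r})"
        using mx True False Suc.prems by auto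
      ultimately show ?thesis by auto
    qed
  next
    case False
    have "\<exists>N. young N \<and> L \<subset> N \<and> maya N = insert (c - 1) (maya L - {r})"
    proof (rule Suc.hyps(1))
      have "r \<noteq> c - 1" using Suc.prems(2) False by auto
      then show "r < c - 1" using Suc.prems(4) by simp
    qed (use Suc.hyps(2) Suc.prems False in auto)
    then obtain N where N: "young N" "L \<subset> N" "maya N = insert (c - 1) (maya L - {r})" by blast
    then obtain x where x: "x \<notin> N" "content x = c" "young (insert x N)"
      using addable_corner[of N c] Suc.prems by auto
    have "maya (insert x N) = insert c (maya L - {r})"
      using maya_insert(1)[OF N(1) x(1,3)] x(2) N(3) False Suc.prems by auto
    then show ?thesis using x N by blast
  qed
qed auto

lemma maya_move_down:
  assumes "young L" "r \<in> maya L" "c \<notin> maya L" "c < r"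
  shows "\<exists>N. young N \<and> N \<subset> L \<and> maya N = insert c (maya L - {r})"
  using assms
proof (induction "nat (r - c)" arbitrary: L c)
  case (Suc m)
  show ?case
  proof (cases "c + 1 \<in> maya L")
    case True
    then obtain x where x: "x \<in> L" "content x = c + 1" "young (L - {x})"
      using removable_corner[of L "c + 1"] Suc.prems by auto
    have mx: "maya (L - {x}) = insert c (maya L - {c + 1})"
      using maya_remove(1)[OF Suc.prems(1) x(1,3), unfolded x(2)] by simp
    show ?thesis
    proof (cases "r = c + 1")
      case True
      then show ?thesis using x mx by blast
    next
      case False
      have "\<exists>N. young N \<and> N \<subset> L - {x} \<and> maya N = insert (c + 1) (maya (L - {x}) - {r})"
        by (rule Suc.hyps(1)) (use Suc.hyps(2) Suc.prems False x mx in auto)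
      moreover have "insert (c + 1) (maya (L - {x}) - {r}) = insert c (maya L - {r})"
        using mx True False Suc.prems by auto
      ultimately show ?thesis by auto
    qed
  next
    case False
    have "\<exists>N. young N \<and> N \<subset> L \<and> maya N = insert (c + 1) (maya L - {r})"
    proof (rule Suc.hyps(1))
      have "r \<noteq> c + 1" using Suc.prems(2) False by auto
      then show "c + 1 < r" using Suc.prems(4) by simp
    qed (use Suc.hyps(2) Suc.prems False in auto)
    then obtain N where N: "young N" "N \<subset> L" "maya N = insert (c + 1) (maya L - {r})" by blast
    then obtain x where x: "x \<in> N" "content x = c + 1" "young (N - {x})"
      using removable_corner[of N "c + 1"] Suc.prems by auto
    have "maya (N - {x}) = insert c (maya L - {r})"
      using maya_remove(1)[OF N(1) x(1,3)] x(2) N(3) False Suc.prems by auto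
    then show ?thesis using x N by blast
  qed
qed auto

text \<open>Hops preserve the number of particles in the window, and the empty diagram has the
  \<open>n\<close> particles from \<open>- n\<close> to \<open>- 1\<close>.\<close>

lemma finite_card_maya:
  assumes "young L" "{..< - int n} \<subseteq> maya L"
  shows "finite (maya L - {..< - int n}) \<and> card (maya L - {..< - int n}) = n"
proof -
  \<comment> \<open>The induction runs on vanishing diagonals up to \<open>- n\<close>, a condition
    that passes to smaller diagrams and keeps the hops inside the window.\<close>
  have "finite (maya L - {..< - int n}) \<and> card (maya L - {..< - int n}) = n"
    if "\<And>k. k \<le> - int n \<Longrightarrow> diag_len L k = 0"
    using \<open>young L\<close> that
  proof (induction L rule: young_induct)
    case empty
    have "{..<0} - {..< - int n} = {- int n..<0}" by auto
    then show ?case by (simp add: maya_empty)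
  next
    case (insert i j L)
    let ?k = "content (i, j)"
    note d = diag_len_insert[OF young_finite[OF insert.hyps(1)] insert.hyps(2)]
    note m = maya_insert[OF insert.hyps(1-3)]
    have k: "- int n < ?k" using insert.prems[of ?k] d[of ?k] by force
    have IH: "finite (maya L - {..< - int n})" "card (maya L - {..< - int n}) = n"
      using insert.IH insert.prems d by auto
    have "maya (insert (i, j) L) - {..< - int n} =
        insert ?k ((maya L - {..< - int n}) - {?k - 1})"
      using m k by auto
    moreover have "card (insert ?k ((maya L - {..< - int n}) - {?k - 1})) = n"
    proof -
      have "?k - 1 \<in> maya L - {..< - int n}" using m k by auto
      then have "Suc (card ((maya L - {..< - int n}) - {?k - 1})) = n"
        using IH by (metis card.remove)
      then show ?thesis using IH(1) m(3) by (subst card_insert_disjoint) auto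
    qed
    ultimately show ?case using IH by simp
  qed
  moreover have "diag_len L k = 0" if "k \<le> - int n" for k
  proof -
    obtain N where N: "\<And>k. N \<le> \<bar>k\<bar> \<Longrightarrow> diag_len L k = 0"
      using diag_len_eventually_0 young_finite assms(1) by metis
    define b where "b = min (- \<bar>N\<bar>) k"
    have "b \<le> k" by (simp add: b_def)
    then have "k \<le> - int n \<longrightarrow> diag_len L k = 0"
    proof (induction k rule: int_ge_induct)
      case base
      then show ?case using N[of b] by (auto simp: b_def)
    next
      case (step k)
      have "k \<in> maya L" if "k + 1 \<le> - int n" using that assms(2) by auto
      then show ?case using diag_len_Suc[OF assms(1), of k] step by auto
    qed
    then show ?thesis using that by blast
  qed
  ultimately show ?thesis by blast
qed

section \<open>Excited diagrams\<close>

text \<open>The same moves as in \<open>excited_diagrams\<close>, but for sets of cells, so that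
  corners can be deleted from either shape without returning to lists.\<close>

inductive_set excited :: "cell set \<Rightarrow> cell set \<Rightarrow> cell set set" for L M :: "cell set" where
  start: "M \<in> excited L M"
| move: "D \<in> excited L M \<Longrightarrow> active L D i j \<Longrightarrow> insert (i + 1, j + 1) (D - {(i, j)}) \<in> excited L M"

lemma excited_diagrams_eq: "excited_diagrams lam mu = excited (diagram lam) (diagram mu)"
proof (intro equalityI subsetI)
  fix D assume "D \<in> excited_diagrams lam mu"
  then show "D \<in> excited (diagram lam) (diagram mu)"
    by induction (auto intro: excited.intros simp del: add_Suc_right Suc_eq_plus1_left One_nat_def)
next
  fix D assume "D \<in> excited (diagram lam) (diagram mu)"
  then show "D \<in> excited_diagrams lam mu"
    by induction (auto intro: excited_diagrams.intros simp del: add_Suc_right Suc_eq_plus1_left One_nat_def)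
qed

lemma excited_subset: "D \<in> excited L M \<Longrightarrow> M \<subseteq> L \<Longrightarrow> D \<subseteq> L"
  by (induction rule: excited.induct) (auto simp: active_def)

lemma finite_excited: "finite L \<Longrightarrow> M \<subseteq> L \<Longrightarrow> finite (excited L M)"
  using excited_subset by (metis PowI finite_Pow_iff finite_subset subsetI)

text \<open>The value 0 for \<open>M\<close> not inside \<open>L\<close> makes the corner recursion
  valid for every \<open>M\<close> and agrees with the vanishing minors.\<close>

definition excited_count :: "cell set \<Rightarrow> cell set \<Rightarrow> nat" where
  "excited_count L M = (if M \<subseteq> L then card (excited L M) else 0)"

lemma excited_self: "excited L L = {L}"
proof (intro equalityI subsetI)
  fix D assume "D \<in> excited L L"
  then show "D \<in> {L}" by induction (auto simp: active_def)
qed (auto intro: excited.start)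

lemma excited_count_self: "excited_count L L = 1"
  by (simp add: excited_count_def excited_self)

section \<open>Recursion at a corner of the outer shape\<close>

context
  fixes L :: "cell set" and a b :: nat
  assumes L: "young L" and x: "(a, b) \<in> L" and L': "young (L - {(a, b)})"
begin

lemma corner_below: "i > a \<Longrightarrow> j \<ge> b \<Longrightarrow> (i, j) \<notin> L"
  using young_down[OF L', of i j a b] young_pos[OF L x] by auto

lemma corner_right: "i \<ge> a \<Longrightarrow> j > b \<Longrightarrow> (i, j) \<notin> L"
  using young_down[OF L', of i j a b] young_pos[OF L x] by auto

text \<open>The corner is never active, so once occupied it stays occupied; a diagram without it
  comes from moves that never touch it.\<close>

lemma excited_without_corner:
  assumes M: "M \<subseteq> L - {(a, b)}"
  shows "{D \<in> excited L M. (a, b) \<notin> D} = excited (L - {(a, b)}) M"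
proof (intro equalityI subsetI)
  fix D assume "D \<in> excited (L - {(a, b)}) M"
  then have "D \<in> excited L M \<and> D \<subseteq> L - {(a, b)}"
  proof induction
    case start
    then show ?case using M excited.start by auto
  next
    case (move D i j)
    then have "active L D i j" by (auto simp: active_def)
    then show ?case using excited.move move by (auto simp: active_def)
  qed
  then show "D \<in> {D \<in> excited L M. (a, b) \<notin> D}" by blast
next
  fix D assume "D \<in> {D \<in> excited L M. (a, b) \<notin> D}"
  then have "D \<in> excited L M" "(a, b) \<notin> D" by auto
  then show "D \<in> excited (L - {(a, b)}) M"
  proof induction
    case start
    then show ?case using excited.start by auto
  next
    case (move D i j)
    \<comment> \<open>If the corner were one of these cells, \<open>(i + 1, j + 1)\<close> or
      \<open>(i + 1, j)\<close> would lie outside \<open>L\<close>.\<close>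
    have n: "(i + 1, j) \<noteq> (a, b)" "(i, j + 1) \<noteq> (a, b)" "(i, j) \<noteq> (a, b)"
      using move.hyps(2) corner_right[of a "b + 1"] corner_below[of "a + 1" b] by (auto simp: active_def)
    then have "(a, b) \<notin> D" "(i + 1, j + 1) \<noteq> (a, b)" using move.prems by auto
    moreover have "active (L - {(a, b)}) D i j"
      using move.hyps(2) n calculation(2) unfolding active_def by auto
    ultimately show ?case using excited.move move.IH by blast
  qed
qed

lemma excited_keeps_corner:
  assumes "D \<in> excited L M" "(a, b) \<in> M"
  shows "(a, b) \<in> D"
  using assms
proof induction
  case (move D i j)
  then have "(i, j) \<noteq> (a, b)" using corner_below[of "a + 1" b] by (auto simp: active_def)
  then show ?case using move by auto
qed

text \<open>Only the last cell on the diagonal of the corner can end there, and it starts as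
  \<open>(c, d)\<close>. Conversely, its slide to the corner can be carried out first, because no
  cell of \<open>M\<close> lies southeast of a removable corner, and the moves for the smaller
  shapes never use the cell \<open>(a, b)\<close>.\<close>

lemma excited_with_corner:
  assumes M: "young M" "M \<subseteq> L" and y: "(c, d) \<in> M" "young (M - {(c, d)})"
    and k: "content (c, d) = content (a, b)"
  shows "{D \<in> excited L M. (a, b) \<in> D} = insert (a, b) ` excited (L - {(a, b)}) (M - {(c, d)})"
proof (intro equalityI subsetI)
  fix D assume "D \<in> {D \<in> excited L M. (a, b) \<in> D}"
  then have D: "D \<in> excited L M" "(a, b) \<in> D" by auto
  \<comment> \<open>\<open>z\<close> is the row of the last cell of \<open>D\<close> on the diagonal of the corner; excited moves never
    overtake it, so deleting it turns a sequence of moves into one for the smaller shapes.\<close>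
  have "\<exists>z. (z, nat (int z + content (a, b))) \<in> D \<and>
      (\<forall>w. w \<in> D \<longrightarrow> content w = content (a, b) \<longrightarrow> fst w \<le> z) \<and>
      D - {(z, nat (int z + content (a, b)))} \<in> excited (L - {(a, b)}) (M - {(c, d)})"
    using D(1)
  proof induction
    case start
    have "fst w \<le> c" if w: "w \<in> M" "content w = content (a, b)" for w
    proof (rule ccontr)
      assume n: "\<not> fst w \<le> c"
      obtain i j where ij: "w = (i, j)" by (cases w)
      have "c < i" "d < j" using n k w(2) by (auto simp: ij content_def)
      then show False using young_down[OF y(2), of i j c d] w(1) young_pos[OF M(1) y(1)] by (auto simp: ij)
    qed
    moreover have "nat (int c + content (a, b)) = d" unfolding k[symmetric] by (simp add: content_def)
    ultimately show ?case using y(1) excited.start by auto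
  next
    case (move D i j)
    let ?h = "\<lambda>z. nat (int z + content (a, b))"
    from move.IH obtain z where z: "(z, ?h z) \<in> D"
      "\<And>w. w \<in> D \<Longrightarrow> content w = content (a, b) \<Longrightarrow> fst w \<le> z"
      "D - {(z, ?h z)} \<in> excited (L - {(a, b)}) (M - {(c, d)})" by blast
    have DL: "D \<subseteq> L" using excited_subset move.hyps(1) M(2) by blast
    have za: "z \<le> a"
    proof (rule ccontr)
      assume "\<not> z \<le> a"
      then have "z > a" "?h z \<ge> b" by (auto simp: content_def)
      then show False using corner_below z(1) DL by blast
    qed
    note act = move.hyps(2)[unfolded active_def]
    show ?case
    proof (cases "(i, j) = (z, ?h z)")
      case True
      have pos: "1 \<le> i" "1 \<le> j" using act DL young_pos[OF L] by auto
      then have "(i + 1, j + 1) = (i + 1, ?h (i + 1))" using True by (auto simp: nat_eq_iff)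
      moreover have "insert (i + 1, j + 1) (D - {(i, j)}) - {(i + 1, j + 1)} = D - {(z, ?h z)}"
        using act True by auto
      moreover have "fst w \<le> i + 1" if "w \<in> insert (i + 1, j + 1) (D - {(i, j)})"
          "content w = content (a, b)" for w
        using z(2)[of w] that True by auto
      ultimately show ?thesis using z(3) by (intro exI[of _ "i + 1"]) auto
    next
      case False
      have iz: "i < z" if "content (i, j) = content (a, b)"
      proof -
        have "i \<le> z" using z(2)[of "(i, j)"] act that by auto
        moreover have "i \<noteq> z" using False that by (auto simp: content_def)
        ultimately show ?thesis by simp
      qed
      have n: "(i + 1, j) \<noteq> (a, b)" "(i, j + 1) \<noteq> (a, b)"
        using act corner_right[of a "b + 1"] corner_below[of "a + 1" b] by auto
      \<comment> \<open>A move into the corner starts on its diagonal above row \<open>z\<close>, so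
        \<open>z = a\<close> and the corner is already occupied.\<close>
      have n3: "(i + 1, j + 1) \<noteq> (a, b)"
      proof
        assume e: "(i + 1, j + 1) = (a, b)"
        then have "content (i, j) = content (a, b)" by (auto simp: content_def)
        then have "z = a" using iz za e by auto
        then have "(z, ?h z) = (i + 1, j + 1)" using e by (auto simp: content_def)
        then show False using z(1) act by auto
      qed
      have "active (L - {(a, b)}) (D - {(z, ?h z)}) i j"
        using act n n3 False unfolding active_def by auto
      then have "insert (i + 1, j + 1) (D - {(z, ?h z)} - {(i, j)}) \<in> excited (L - {(a, b)}) (M - {(c, d)})"
        using excited.move z(3) by blast
      moreover have "(i + 1, j + 1) \<noteq> (z, ?h z)" using act z(1) by auto
      then have "insert (i + 1, j + 1) (D - {(i, j)}) - {(z, ?h z)} =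
          insert (i + 1, j + 1) (D - {(z, ?h z)} - {(i, j)})" by auto
      moreover have "(z, ?h z) \<in> insert (i + 1, j + 1) (D - {(i, j)})" using z(1) False by auto
      moreover have "fst w \<le> z" if "w \<in> insert (i + 1, j + 1) (D - {(i, j)})"
          "content w = content (a, b)" for w
      proof (cases "w = (i + 1, j + 1)")
        case True
        then have "content (i, j) = content (a, b)" using that(2) by (auto simp: content_def)
        then show ?thesis using iz True by simp
      next
        case False
        then show ?thesis using that z(2) by auto
      qed
      ultimately show ?thesis by (intro exI[of _ z]) simp
    qed
  qed
  then obtain z where z: "(z, nat (int z + content (a, b))) \<in> D"
      "\<And>w. w \<in> D \<Longrightarrow> content w = content (a, b) \<Longrightarrow> fst w \<le> z"
      "D - {(z, nat (int z + content (a, b)))} \<in> excited (L - {(a, b)}) (M - {(c, d)})" by blast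
  have "a \<le> z" using z(2)[OF D(2)] by simp
  moreover have "z \<le> a"
  proof (rule ccontr)
    assume "\<not> z \<le> a"
    then have "z > a" "nat (int z + content (a, b)) \<ge> b" by (auto simp: content_def)
    then show False using corner_below z(1) excited_subset[OF D(1) M(2)] by blast
  qed
  ultimately have "D - {(a, b)} \<in> excited (L - {(a, b)}) (M - {(c, d)})"
    using z(3) by (simp add: content_def)
  then show "D \<in> insert (a, b) ` excited (L - {(a, b)}) (M - {(c, d)})"
    using D(2) by (intro image_eqI[of _ _ "D - {(a, b)}"]) auto
next
  fix D assume "D \<in> insert (a, b) ` excited (L - {(a, b)}) (M - {(c, d)})"
  then obtain D' where D': "D' \<in> excited (L - {(a, b)}) (M - {(c, d)})" "D = insert (a, b) D'" by blast
  have pos: "1 \<le> c" "1 \<le> d" using young_pos[OF M(1) y(1)] by auto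
  have ca: "c \<le> a"
  proof (rule ccontr)
    assume "\<not> c \<le> a"
    then have "c > a" "d \<ge> b" using k by (auto simp: content_def)
    then show False using corner_below y(1) M(2) by blast
  qed
  have db: "b + c = a + d" using k by (auto simp: content_def)
  have slide: "insert (c + s, d + s) (M - {(c, d)}) \<in> excited L M" if "c + s \<le> a" for s
    using that
  proof (induction s)
    case 0
    then show ?case using y(1) excited.start by (simp add: insert_absorb)
  next
    case (Suc s)
    let ?D = "insert (c + s, d + s) (M - {(c, d)})"
    have inL: "(i, j) \<in> L" if "1 \<le> i" "i \<le> c + s + 1" "1 \<le> j" "j \<le> d + s + 1" for i j
      by (rule young_down[OF L x]) (use Suc.prems db that in auto)
    have notM: "(i, j) \<notin> M - {(c, d)}" if "c \<le> i" "d \<le> j" for i j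
      using young_down[OF y(2), of i j c d] that pos by auto
    have "active L ?D (c + s) (d + s)"
      unfolding active_def using inL pos notM[of "c + s + 1" "d + s"] notM[of "c + s" "d + s + 1"]
        notM[of "c + s + 1" "d + s + 1"] by auto
    then have "insert (c + s + 1, d + s + 1) (?D - {(c + s, d + s)}) \<in> excited L M"
      by (rule excited.move[rotated]) (use Suc in simp)
    moreover have "?D - {(c + s, d + s)} = M - {(c, d)}" using notM[of "c + s" "d + s"] by auto
    ultimately show ?case by simp
  qed
  have "insert (a, b) D' \<in> excited L M \<and> D' \<subseteq> L - {(a, b)}"
    using D'(1)
  proof induction
    case start
    have "d + (a - c) = b" using ca db by simp
    then have "insert (a, b) (M - {(c, d)}) \<in> excited L M" using slide[of "a - c"] ca by simp
    moreover have "(a, b) \<notin> M - {(c, d)}"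
      using young_down[OF y(2), of a b c d] ca db pos by auto
    ultimately show ?case using M(2) by auto
  next
    case (move D i j)
    have "active L (insert (a, b) D) i j" "(i, j) \<noteq> (a, b)"
      using move.hyps(2) move.IH unfolding active_def by auto
    moreover from this have "insert (i + 1, j + 1) (insert (a, b) D - {(i, j)}) =
        insert (a, b) (insert (i + 1, j + 1) (D - {(i, j)}))" by auto
    ultimately have "insert (a, b) (insert (i + 1, j + 1) (D - {(i, j)})) \<in> excited L M"
      using excited.move move.IH by metis
    then show ?case using move by (auto simp: active_def)
  qed
  then show "D \<in> {D \<in> excited L M. (a, b) \<in> D}" using D'(2) by auto
qed

text \<open>The blocking condition \<open>H\<close> is invariant under excited moves. For the corner
  itself the blocking cell would lie below row \<open>a\<close> and not left of column
  \<open>b\<close>, hence outside \<open>L\<close>.\<close>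

lemma corner_unreachable_below:
  assumes "M \<subseteq> L" and H: "\<And>w. w \<in> M \<Longrightarrow> content w = content (a, b) \<Longrightarrow>
      \<exists>v\<in>M. content v = content (a, b) - 1 \<and> fst w < fst v"
    and D: "D \<in> excited L M"
  shows "(a, b) \<notin> D"
proof
  assume "(a, b) \<in> D"
  have "\<forall>w\<in>D. content w = content (a, b) \<longrightarrow>
      (\<exists>v\<in>D. content v = content (a, b) - 1 \<and> fst w < fst v)"
    using D
  proof induction
    case start
    then show ?case using H by blast
  next
    case (move D i j)
    let ?D = "insert (i + 1, j + 1) (D - {(i, j)})"
    show ?case
    proof (intro ballI impI)
      fix w assume w: "w \<in> ?D" "content w = content (a, b)"
      show "\<exists>v\<in>?D. content v = content (a, b) - 1 \<and> fst w < fst v"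
      proof (cases "w = (i + 1, j + 1)")
        case True
        then have ij: "content (i, j) = content (a, b)" using w by (auto simp: content_def)
        then obtain v where v: "v \<in> D" "content v = content (a, b) - 1" "i < fst v"
          using move by (auto simp: active_def)
        \<comment> \<open>A cell of the blocking diagonal in row \<open>i + 1\<close> would be
          \<open>(i + 1, j)\<close>, which must be free for \<open>(i, j)\<close> to be active. So
          \<open>v\<close> is further down and still blocks the moved cell.\<close>
        have "v \<noteq> (i + 1, j)" using v move.hyps(2) by (auto simp: active_def)
        then have "fst v \<noteq> i + 1" using v ij by (cases v) (auto simp: content_def)
        then show ?thesis using v ij True by (intro bexI[of _ v]) auto
      next
        case False
        then obtain v where v: "v \<in> D" "content v = content (a, b) - 1" "fst w < fst v"
          using move.IH w by auto
        show ?thesis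
        proof (cases "v = (i, j)")
          case True
          then show ?thesis using v by (intro bexI[of _ "(i + 1, j + 1)"]) (auto simp: content_def)
        next
          case False
          then show ?thesis using v by (intro bexI[of _ v]) auto
        qed
      qed
    qed
  qed
  then obtain i j where v: "(i, j) \<in> D" "content (i, j) = content (a, b) - 1" "a < i"
    using \<open>(a, b) \<in> D\<close> by force
  then have "b \<le> j" by (auto simp: content_def)
  then show False using corner_below[of i j] v excited_subset[OF D assms(1)] by blast
qed

text \<open>The transposed argument, with columns in place of rows.\<close>

lemma corner_unreachable_right:
  assumes "M \<subseteq> L" and H: "\<And>w. w \<in> M \<Longrightarrow> content w = content (a, b) \<Longrightarrow>
      \<exists>v\<in>M. content v = content (a, b) + 1 \<and> snd w < snd v"
    and D: "D \<in> excited L M"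
  shows "(a, b) \<notin> D"
proof
  assume "(a, b) \<in> D"
  have "\<forall>w\<in>D. content w = content (a, b) \<longrightarrow>
      (\<exists>v\<in>D. content v = content (a, b) + 1 \<and> snd w < snd v)"
    using D
  proof induction
    case start
    then show ?case using H by blast
  next
    case (move D i j)
    let ?D = "insert (i + 1, j + 1) (D - {(i, j)})"
    show ?case
    proof (intro ballI impI)
      fix w assume w: "w \<in> ?D" "content w = content (a, b)"
      show "\<exists>v\<in>?D. content v = content (a, b) + 1 \<and> snd w < snd v"
      proof (cases "w = (i + 1, j + 1)")
        case True
        then have ij: "content (i, j) = content (a, b)" using w by (auto simp: content_def)
        then obtain v where v: "v \<in> D" "content v = content (a, b) + 1" "j < snd v"
          using move by (auto simp: active_def)
        have "v \<noteq> (i, j + 1)" using v move.hyps(2) by (auto simp: active_def)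
        then have "snd v \<noteq> j + 1" using v ij by (cases v) (auto simp: content_def)
        then show ?thesis using v ij True by (intro bexI[of _ v]) auto
      next
        case False
        then obtain v where v: "v \<in> D" "content v = content (a, b) + 1" "snd w < snd v"
          using move.IH w by auto
        show ?thesis
        proof (cases "v = (i, j)")
          case True
          then show ?thesis using v by (intro bexI[of _ "(i + 1, j + 1)"]) (auto simp: content_def)
        next
          case False
          then show ?thesis using v by (intro bexI[of _ v]) auto
        qed
      qed
    qed
  qed
  then obtain i j where v: "(i, j) \<in> D" "content (i, j) = content (a, b) + 1" "b < j"
    using \<open>(a, b) \<in> D\<close> by force
  then have "a \<le> i" by (auto simp: content_def)
  then show False using corner_right[of i j] v excited_subset[OF D assms(1)] by blast
qed

text \<open>The last cell of a neighbouring diagonal of \<open>M\<close> blocks the way. If position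
  \<open>content (a, b) - 1\<close> is occupied, the one on the diagonal before is further down than
  every cell of \<open>M\<close> on the corner's diagonal; if \<open>content (a, b)\<close> is
  vacant, the one on the diagonal after is further right.\<close>

lemma excited_count_rec_stuck:
  assumes M: "young M" and k: "content (a, b) \<notin> maya M \<or> content (a, b) - 1 \<in> maya M"
  shows "excited_count L M = excited_count (L - {(a, b)}) M"
proof (cases "M \<subseteq> L")
  case True
  let ?k = "content (a, b)"
  have n: "(a, b) \<notin> D" if "D \<in> excited L M" for D
  proof (cases "?k - 1 \<in> maya M")
    case k: True
    have "\<exists>v\<in>M. content v = ?k - 1 \<and> fst w < fst v" if w: "w \<in> M" "content w = ?k" for w
    proof -
      obtain s where s: "w = diag_cell ?k s" using diag_cell_cases w(2) by metis
      then have "1 \<le> s \<and> s \<le> diag_len M ?k" using w(1) diag_cell_mem_iff[OF M] by blast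
      then show ?thesis
        using diag_len_pred[OF M, of ?k] k s
        by (intro bexI[of _ "diag_cell (?k - 1) (diag_len M (?k - 1))"])
          (auto simp: diag_cell_mem_iff[OF M] content_diag_cell, auto simp: diag_cell_def split: if_splits)
    qed
    then show ?thesis using corner_unreachable_below[OF True _ that] by blast
  next
    case False
    then have k: "?k \<notin> maya M" using k by blast
    have "\<exists>v\<in>M. content v = ?k + 1 \<and> snd w < snd v" if w: "w \<in> M" "content w = ?k" for w
    proof -
      obtain s where s: "w = diag_cell ?k s" using diag_cell_cases w(2) by metis
      then have "1 \<le> s \<and> s \<le> diag_len M ?k" using w(1) diag_cell_mem_iff[OF M] by blast
      then show ?thesis
        using diag_len_Suc[OF M, of ?k] k s
        by (intro bexI[of _ "diag_cell (?k + 1) (diag_len M (?k + 1))"])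
          (auto simp: diag_cell_mem_iff[OF M] content_diag_cell, auto simp: diag_cell_def split: if_splits)
    qed
    then show ?thesis using corner_unreachable_right[OF True _ that] by blast
  qed
  then have "M \<subseteq> L - {(a, b)}" using True excited.start[of M L] by blast
  moreover from this n have "excited L M = excited (L - {(a, b)}) M"
    using excited_without_corner by blast
  ultimately show ?thesis using True by (simp add: excited_count_def)
next
  case False
  then show ?thesis by (auto simp: excited_count_def)
qed

lemma excited_count_rec_corner:
  assumes M: "young M" and y: "y \<in> M" "young (M - {y})" and k: "content y = content (a, b)"
  shows "excited_count L M = excited_count (L - {(a, b)}) M + excited_count (L - {(a, b)}) (M - {y})"
proof -
  let ?L = "L - {(a, b)}" and ?M = "M - {y}"
  have dL: "diag_len L i = diag_len ?L i + (if i = content (a, b) then 1 else 0)" for i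
    using diag_len_insert[of ?L "(a, b)" i] x young_finite[OF L'] by (simp add: insert_absorb)
  have dM: "diag_len M i = diag_len ?M i + (if i = content (a, b) then 1 else 0)" for i
    using diag_len_insert[of ?M y i] y(1) k young_finite[OF y(2)] by (simp add: insert_absorb)
  \<comment> \<open>Both shapes lose a cell on the same diagonal, so the default value 0 applies to
    the last summand exactly when it applies to the left-hand side.\<close>
  have sub: "?M \<subseteq> ?L \<longleftrightarrow> M \<subseteq> L"
    unfolding young_subset_iff[OF L' y(2)] young_subset_iff[OF L M] dL dM by simp
  show ?thesis
  proof (cases "M \<subseteq> L")
    case True
    obtain c d where cd: "y = (c, d)" by (cases y)
    have fin: "finite (excited L M)" using finite_excited young_finite[OF L] True by blast
    have "card (excited L M) = card {D \<in> excited L M. (a, b) \<notin> D} + card {D \<in> excited L M. (a, b) \<in> D}"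
      using fin by (subst card_Un_disjoint[symmetric]) (auto intro!: arg_cong[of _ _ card])
    also have "{D \<in> excited L M. (a, b) \<in> D} = insert (a, b) ` excited ?L ?M"
      unfolding cd by (rule excited_with_corner) (use True M y k in \<open>auto simp: cd\<close>)
    also have "card (insert (a, b) ` excited ?L ?M) = card (excited ?L ?M)"
    proof (rule card_image, rule inj_onI)
      fix D E assume DE: "D \<in> excited ?L ?M" "E \<in> excited ?L ?M" "insert (a, b) D = insert (a, b) E"
      have "(a, b) \<notin> D" "(a, b) \<notin> E" using excited_subset DE(1,2) sub True by blast+
      then show "D = E" using DE(3) by (metis insert_ident)
    qed
    also have "card {D \<in> excited L M. (a, b) \<notin> D} = excited_count ?L M"
    proof (cases "(a, b) \<in> M")
      case True
      then have "{D \<in> excited L M. (a, b) \<notin> D} = {}" using excited_keeps_corner by blast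
      moreover have "\<not> M \<subseteq> ?L" using True by blast
      ultimately show ?thesis by (simp only: excited_count_def card.empty if_False)
    next
      case False
      then have "M \<subseteq> ?L" using \<open>M \<subseteq> L\<close> by blast
      then show ?thesis using excited_without_corner by (simp add: excited_count_def)
    qed
    finally show ?thesis using True sub by (simp add: excited_count_def)
  next
    case False
    then have "\<not> M \<subseteq> ?L" by blast
    then show ?thesis using False sub unfolding excited_count_def by simp
  qed
qed

end

section \<open>Border strips\<close>

lemma young_diagram:
  assumes "is_partition lam"
  shows "young (diagram lam)"
proof -
  have mono: "lam ! i' \<ge> lam ! i" if "i' \<le> i" "i < length lam" for i i'
    using assms that unfolding is_partition_def
    by (cases "i = i'") (auto simp: sorted_wrt_iff_nth_less)
  have "diagram lam \<subseteq> {..length lam} \<times> {..Max (set lam)}"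
  proof (clarify, intro conjI SigmaI)
    fix i j assume "(i, j) \<in> diagram lam"
    then have "i \<le> length lam" "i - 1 < length lam" "j \<le> lam ! (i - 1)" by (auto simp: diagram_def)
    then show "i \<in> {..length lam}" "j \<in> {..Max (set lam)}"
      using Max_ge[of "set lam" "lam ! (i - 1)"] by (auto intro: order_trans)
  qed
  then have "finite (diagram lam)" by (rule finite_subset) auto
  moreover have "(i', j') \<in> diagram lam"
    if "(i, j) \<in> diagram lam" "1 \<le> i'" "i' \<le> i" "1 \<le> j'" "j' \<le> j" for i j i' j'
  proof -
    have "lam ! (i - 1) \<le> lam ! (i' - 1)" by (rule mono) (use that in \<open>auto simp: diagram_def\<close>)
    then show ?thesis using that by (auto simp: diagram_def)
  qed
  moreover have "1 \<le> i \<and> 1 \<le> j" if "(i, j) \<in> diagram lam" for i j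
    using that by (auto simp: diagram_def)
  ultimately show ?thesis unfolding young_def by blast
qed

lemma diagram_inject:
  assumes "is_partition lam" "is_partition mu" "diagram lam = diagram mu"
  shows "lam = mu"
proof -
  have len: "length \<nu> = card {i. (i, 1) \<in> diagram \<nu>}" if "is_partition \<nu>" for \<nu>
  proof -
    have "{i. (i, 1) \<in> diagram \<nu>} = {1..length \<nu>}"
      using that by (auto simp: diagram_def is_partition_def Suc_le_eq)
    then show ?thesis by simp
  qed
  have row: "\<nu> ! i = card {j. (Suc i, j) \<in> diagram \<nu>}" if "i < length \<nu>" for \<nu> i
  proof -
    have "{j. (Suc i, j) \<in> diagram \<nu>} = {1..\<nu> ! i}" using that by (auto simp: diagram_def)
    then show ?thesis by simp
  qed
  have l: "length lam = length mu" using len assms by simp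
  then show ?thesis using row assms(3) by (intro nth_equalityI) auto
qed

lemma partition_of_young:
  assumes L: "young L"
  obtains lam where "is_partition lam" "diagram lam = L"
proof -
  define row where "row i = {j. (i, j) \<in> L}" for i
  define rows where "rows = {i. (i, 1) \<in> L}"
  have finr: "finite (row i)" for i
  proof (rule finite_subset)
    show "row i \<subseteq> snd ` L" by (force simp: row_def)
  qed (use young_finite[OF L] in simp)
  have "finite rows"
  proof (rule finite_subset)
    show "rows \<subseteq> fst ` L" by (force simp: rows_def)
  qed (use young_finite[OF L] in simp)
  then have rows: "rows = {1..card rows}"
  proof (rule initial_segment)
    fix i i' assume i: "i \<in> rows"
    then show "1 \<le> i" using young_pos[OF L] unfolding rows_def by blast
    assume "1 \<le> i'" "i' \<le> i"
    then show "i' \<in> rows" using i young_down[OF L, of i 1 i' 1] unfolding rows_def by blast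
  qed
  have row: "row i = {1..card (row i)}" for i
  proof (rule initial_segment[OF finr])
    fix j j' assume j: "j \<in> row i"
    then show "1 \<le> j" using young_pos[OF L] unfolding row_def by blast
    assume "1 \<le> j'" "j' \<le> j"
    then show "j' \<in> row i" using j young_pos[OF L, of i j] young_down[OF L, of i j i j'] unfolding row_def by blast
  qed
  define lam where "lam = map (\<lambda>i. card (row (Suc i))) [0..<card rows]"
  have mem: "(i, j) \<in> L \<longleftrightarrow> 1 \<le> i \<and> i \<le> card rows \<and> 1 \<le> j \<and> j \<le> card (row i)" for i j
  proof
    assume "(i, j) \<in> L"
    then have "i \<in> rows" "j \<in> row i"
      using young_pos[OF L] young_down[OF L, of i j i 1] by (auto simp: rows_def row_def)
    then show "1 \<le> i \<and> i \<le> card rows \<and> 1 \<le> j \<and> j \<le> card (row i)"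
      using rows row[of i] by (metis atLeastAtMost_iff)
  next
    assume "1 \<le> i \<and> i \<le> card rows \<and> 1 \<le> j \<and> j \<le> card (row i)"
    then have "j \<in> row i" using row[of i] by (metis atLeastAtMost_iff)
    then show "(i, j) \<in> L" by (simp add: row_def)
  qed
  have "diagram lam = L"
    by (auto simp: diagram_def lam_def mem)
  moreover have "is_partition lam"
  proof -
    have "card (row (Suc j)) \<le> card (row (Suc i))" if "i < j" for i j
    proof (rule card_mono[OF finr], rule subsetI)
      fix l assume "l \<in> row (Suc j)"
      then show "l \<in> row (Suc i)"
        using young_down[OF L, of "Suc j" l "Suc i" l] young_pos[OF L, of "Suc j" l] that by (auto simp: row_def)
    qed
    moreover have "0 < card (row (Suc i))" if "i < card rows" for i
    proof -
      have "Suc i \<in> rows" using that rows by (metis Suc_leI atLeastAtMost_iff le_add1 plus_1_eq_Suc)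
      then have "1 \<in> row (Suc i)" by (simp add: row_def rows_def)
      then show ?thesis using finr card_gt_0_iff by blast
    qed
    ultimately show ?thesis
      by (auto simp: is_partition_def lam_def sorted_wrt_iff_nth_less)
  qed
  ultimately show ?thesis using that by blast
qed

text \<open>A translation written as a preimage, so that no subtraction is truncated; cells leaving
  the positive quadrant are dropped. For \<open>p = q = t\<close> it is also what remains of a
  diagram after \<open>t\<close> peelings.\<close>

definition shift_back :: "nat \<Rightarrow> nat \<Rightarrow> cell set \<Rightarrow> cell set" where
  "shift_back p q X = {(i, j). 1 \<le> i \<and> 1 \<le> j \<and> (i + p, j + q) \<in> X}"

lemma mem_shift_back: "(i, j) \<in> shift_back p q X \<longleftrightarrow> 1 \<le> i \<and> 1 \<le> j \<and> (i + p, j + q) \<in> X"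
  by (simp add: shift_back_def)

lemma young_shift_back:
  assumes L: "young L"
  shows "young (shift_back p q L)"
proof -
  have "shift_back p q L \<subseteq> (\<lambda>(i, j). (i - p, j - q)) ` L"
    by (force simp: shift_back_def)
  then have "finite (shift_back p q L)" by (rule finite_subset) (use young_finite[OF L] in simp)
  moreover have "(i', j') \<in> shift_back p q L"
    if "(i, j) \<in> shift_back p q L" "1 \<le> i'" "i' \<le> i" "1 \<le> j'" "j' \<le> j" for i j i' j'
    using that young_down[OF L, of "i + p" "j + q" "i' + p" "j' + q"] by (auto simp: mem_shift_back)
  moreover have "1 \<le> i \<and> 1 \<le> j" if "(i, j) \<in> shift_back p q L" for i j
    using that by (simp add: mem_shift_back)
  ultimately show ?thesis unfolding young_def by blast
qed

text \<open>The cells of \<open>L\<close> above row \<open>p + 1\<close> or left of column \<open>q + 1\<close> are in every excited diagram,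
  so only the translated remainder matters.\<close>

lemma card_excited_shift_back:
  assumes L: "young L" and NL: "N \<subseteq> L" and S: "\<And>i j. (i, j) \<in> L - N \<Longrightarrow> p < i \<and> q < j"
  shows "card (excited (shift_back p q L) (shift_back p q N)) = card (excited L N)"
proof -
  let ?Q = "{(i, j). p < i \<and> q < j}"
  have fwd: "shift_back p q D \<in> excited (shift_back p q L) (shift_back p q N) \<and> L - ?Q \<subseteq> D \<and> D \<subseteq> L"
    if "D \<in> excited L N" for D
    using that
  proof induction
    case start
    have "L - ?Q \<subseteq> N" using S by auto
    then show ?case using NL excited.start by simp
  next
    case (move D i j)
    note act = move.hyps(2)[unfolded active_def]
    \<comment> \<open>The neighbours of an active cell are outside \<open>D\<close>, hence in
      \<open>?Q\<close>; the first gives \<open>q < j\<close> and the second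
      \<open>p < i\<close>.\<close>
    have "(i + 1, j) \<in> ?Q" "(i, j + 1) \<in> ?Q" using act move.IH by blast+
    then have ij: "p < i" "q < j" by auto
    define i' j' where "i' = i - p" and "j' = j - q"
    have [simp]: "i = i' + p" "j = j' + q" "Suc 0 \<le> i'" "Suc 0 \<le> j'" using ij by (auto simp: i'_def j'_def)
    have "active (shift_back p q L) (shift_back p q D) i' j'"
      using act by (auto simp: active_def mem_shift_back)
    then have "insert (i' + 1, j' + 1) (shift_back p q D - {(i', j')}) \<in> excited (shift_back p q L) (shift_back p q N)"
      using excited.move move.IH by blast
    moreover have "insert (i' + 1, j' + 1) (shift_back p q D - {(i', j')}) =
        shift_back p q (insert (i + 1, j + 1) (D - {(i, j)}))"
      by (auto simp: shift_back_def)
    ultimately show ?case using move.IH act ij by auto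
  qed
  have bwd: "\<exists>D\<in>excited L N. shift_back p q D = D'" if "D' \<in> excited (shift_back p q L) (shift_back p q N)" for D'
    using that
  proof induction
    case start
    then show ?case using excited.start by blast
  next
    case (move D' i j)
    then obtain D where D: "D \<in> excited L N" "shift_back p q D = D'" by blast
    note act = move.hyps(2)[unfolded active_def]
    have "active L D (i + p) (j + q)"
      using act by (auto simp: active_def mem_shift_back D(2)[symmetric])
    then have "insert (i + p + 1, j + q + 1) (D - {(i + p, j + q)}) \<in> excited L N"
      using D(1) excited.move by blast
    moreover have "shift_back p q (insert (i + p + 1, j + q + 1) (D - {(i + p, j + q)})) =
        insert (i + 1, j + 1) (D' - {(i, j)})"
      unfolding D(2)[symmetric] by (auto simp: shift_back_def)
    ultimately show ?case by blast
  qed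
  have "inj_on (shift_back p q) (excited L N)"
  proof (rule inj_onI)
    fix D E assume DE: "D \<in> excited L N" "E \<in> excited L N" "shift_back p q D = shift_back p q E"
    have "(i, j) \<in> D \<longleftrightarrow> (i, j) \<in> E" for i j
    proof (cases "p < i \<and> q < j")
      case True
      then have "(i, j) \<in> X \<longleftrightarrow> (i - p, j - q) \<in> shift_back p q X" for X by (auto simp: mem_shift_back)
      then show ?thesis using DE(3) by simp
    next
      case False
      then have "(i, j) \<in> X \<longleftrightarrow> (i, j) \<in> L" if "X \<in> excited L N" for X
        using fwd[OF that] by blast
      then show ?thesis using DE by simp
    qed
    then show "D = E" by auto
  qed
  moreover have "shift_back p q ` excited L N = excited (shift_back p q L) (shift_back p q N)"
  proof (intro equalityI subsetI)
    fix D' assume "D' \<in> excited (shift_back p q L) (shift_back p q N)"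
    then show "D' \<in> shift_back p q ` excited L N" using bwd by force
  qed (use fwd in blast)
  ultimately show ?thesis using card_image by metis
qed

text \<open>By \<open>corner\<close>, every cell of \<open>L\<close> in the bounding quadrant of
  \<open>S\<close> is weakly northwest of a cell of \<open>S\<close>. So the translate of
  \<open>L\<close> is the smallest partition around the normalized strip, and the translate of
  \<open>N\<close> is the complement of the strip in it.\<close>

lemma strip_excited_eq:
  assumes L: "young L" and N: "young N" "N \<subseteq> L" and S: "S = L - N" "S \<noteq> {}"
    and corner: "\<And>i j. (i, j) \<in> L \<Longrightarrow> Min (fst ` S) \<le> i \<Longrightarrow> Min (snd ` S) \<le> j \<Longrightarrow>
      \<exists>i' j'. (i', j') \<in> S \<and> i \<le> i' \<and> j \<le> j'"
  shows "strip_excited S = excited_count L N"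
proof -
  have fin: "finite S" using S(1) young_finite[OF L] by simp
  have "Min (fst ` S) \<in> fst ` S" "Min (snd ` S) \<in> snd ` S" using fin S(2) by auto
  then have "1 \<le> Min (fst ` S)" "1 \<le> Min (snd ` S)"
    using young_pos[OF L] unfolding S(1) by fastforce+
  then obtain p q where pq: "Min (fst ` S) = Suc p" "Min (snd ` S) = Suc q"
    by (metis Suc_le_D One_nat_def)
  have Spq: "p < i \<and> q < j" if "(i, j) \<in> S" for i j
    using Min_le[of "fst ` S" i] Min_le[of "snd ` S" j] that fin pq by force
  have norm: "normalize_cells S = shift_back p q S"
  proof (intro Set.set_eqI iffI)
    fix x assume "x \<in> normalize_cells S"
    then obtain i j where "(i, j) \<in> S" "x = (i - p, j - q)"
      unfolding normalize_cells_def pq by auto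
    then show "x \<in> shift_back p q S" using Spq[of i j] by (auto simp: mem_shift_back)
  next
    fix x assume "x \<in> shift_back p q S"
    then obtain i j where x: "x = (i, j)" "(i + p, j + q) \<in> S" by (cases x) (auto simp: mem_shift_back)
    then have "x = (\<lambda>(i, j). (i + 1 - Min (fst ` S), j + 1 - Min (snd ` S))) (i + p, j + q)"
      by (simp add: pq)
    then show "x \<in> normalize_cells S" unfolding normalize_cells_def using x(2) by blast
  qed
  obtain \<alpha> where \<alpha>: "is_partition \<alpha>" "diagram \<alpha> = shift_back p q L"
    using partition_of_young[OF young_shift_back[OF L]] by blast
  obtain \<beta> where \<beta>: "is_partition \<beta>" "diagram \<beta> = shift_back p q N"
    using partition_of_young[OF young_shift_back[OF N(1)]] by blast
  have least: "shift_back p q L \<subseteq> diagram \<gamma>" if \<gamma>: "is_partition \<gamma>" "shift_back p q S \<subseteq> diagram \<gamma>" for \<gamma>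
  proof
    fix x assume "x \<in> shift_back p q L"
    then obtain i j where x: "x = (i, j)" "1 \<le> i" "1 \<le> j" "(i + p, j + q) \<in> L"
      by (cases x) (auto simp: mem_shift_back)
    then obtain i' j' where ij: "(i', j') \<in> S" "i + p \<le> i'" "j + q \<le> j'"
      using corner[of "i + p" "j + q"] pq by auto
    then have "(i' - p, j' - q) \<in> shift_back p q S" using Spq[of i' j'] by (auto simp: mem_shift_back)
    then have "(i' - p, j' - q) \<in> diagram \<gamma>" using \<gamma>(2) by blast
    then show "x \<in> diagram \<gamma>"
      unfolding x(1) by (rule young_down[OF young_diagram[OF \<gamma>(1)]]) (use x ij in auto)
  qed
  have sub: "shift_back p q S \<subseteq> shift_back p q L" unfolding S(1) by (auto simp: shift_back_def)
  have "smallest_partition (shift_back p q S) = \<alpha>"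
    unfolding smallest_partition_def
  proof (rule the_equality)
    show "is_partition \<alpha> \<and> shift_back p q S \<subseteq> diagram \<alpha> \<and>
        (\<forall>\<gamma>. is_partition \<gamma> \<and> shift_back p q S \<subseteq> diagram \<gamma> \<longrightarrow> diagram \<alpha> \<subseteq> diagram \<gamma>)"
      using \<alpha> least sub by auto
  next
    fix \<gamma> assume \<gamma>: "is_partition \<gamma> \<and> shift_back p q S \<subseteq> diagram \<gamma> \<and>
        (\<forall>\<delta>. is_partition \<delta> \<and> shift_back p q S \<subseteq> diagram \<delta> \<longrightarrow> diagram \<gamma> \<subseteq> diagram \<delta>)"
    then have "diagram \<gamma> \<subseteq> diagram \<alpha>" using \<alpha> sub by metis
    moreover have "diagram \<alpha> \<subseteq> diagram \<gamma>" using \<alpha>(2) least \<gamma> by auto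
    ultimately show "\<gamma> = \<alpha>" using diagram_inject \<gamma> \<alpha>(1) by blast
  qed
  moreover have "(THE \<beta>. is_partition \<beta> \<and> diagram \<beta> = diagram \<alpha> - shift_back p q S) = \<beta>"
  proof (rule the_equality)
    have "shift_back p q N = shift_back p q L - shift_back p q S" using S(1) N(2) by (auto simp: shift_back_def)
    then show *: "is_partition \<beta> \<and> diagram \<beta> = diagram \<alpha> - shift_back p q S" using \<alpha> \<beta> by simp
    fix \<gamma> assume "is_partition \<gamma> \<and> diagram \<gamma> = diagram \<alpha> - shift_back p q S"
    then show "\<gamma> = \<beta>" using * diagram_inject by auto
  qed
  ultimately have "strip_excited S = num_excited \<alpha> \<beta>"
    using S(2) by (simp add: strip_excited_def norm)
  also have "\<dots> = card (excited L N)"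
    unfolding num_excited_def excited_diagrams_eq \<alpha> \<beta>
    by (rule card_excited_shift_back[OF L N(2)]) (use Spq S(1) in auto)
  finally show ?thesis using N(2) by (simp add: excited_count_def)
qed

section \<open>Outer border strips as the last cells of the diagonals\<close>

lemma outer_strip_iff:
  assumes "young L"
  shows "diag_cell k s \<in> outer_strip L \<longleftrightarrow> 1 \<le> s \<and> s = diag_len L k"
proof -
  have "diag_cell k s \<in> outer_strip L \<longleftrightarrow> diag_cell k s \<in> L \<and> diag_cell k (s + 1) \<notin> L"
    by (simp add: outer_strip_def diag_cell_def)
  then show ?thesis by (auto simp: diag_cell_mem_iff[OF assms])
qed

text \<open>Of two strip cells neither is strictly southeast of the other, since \<open>L\<close>
  would then contain the diagonal successor of the other. Content thus orders the strip from
  southwest to northeast.\<close>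

lemma outer_strip_monotone:
  assumes L: "young L" and x: "(i, j) \<in> outer_strip L" and y: "(i', j') \<in> outer_strip L"
    and c: "content (i, j) \<le> content (i', j')"
  shows "i' \<le> i" "j \<le> j'"
proof -
  have *: "(i, j) \<in> L" "(i + 1, j + 1) \<notin> L" "(i', j') \<in> L" "(i' + 1, j' + 1) \<notin> L"
    using x y by (auto simp: outer_strip_def)
  show "i' \<le> i"
  proof (rule ccontr)
    assume "\<not> i' \<le> i"
    then have "i + 1 \<le> i'" "j + 1 \<le> j'" using c by (auto simp: content_def)
    then show False using young_down[OF L *(3), of "i + 1" "j + 1"] *(2) by simp
  qed
  show "j \<le> j'"
  proof (rule ccontr)
    assume "\<not> j \<le> j'"
    then have "i' + 1 \<le> i" "j' + 1 \<le> j" using c by (auto simp: content_def)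
    then show False using young_down[OF L *(1), of "i' + 1" "j' + 1"] *(4) by simp
  qed
qed

text \<open>Moving a particle from \<open>r\<close> down to \<open>c\<close> shortens exactly the
  diagonals \<open>c + 1\<close> to \<open>r\<close> by one, which removes the outer strip over
  these contents. The hole at \<open>c\<close> and the particle at \<open>r\<close> say that
  \<open>L\<close> has no cell below the first and none right of the last cell of this strip, so
  \<open>L\<close> fits tightly around it.\<close>

lemma strip_excited_outer_strip:
  assumes L: "young L" and r: "r \<in> maya L" and c: "c \<notin> maya L" "c < r"
    and N: "young N" "maya N = insert c (maya L - {r})"
  shows "strip_excited {x \<in> outer_strip L. c < content x \<and> content x \<le> r} = excited_count L N"
proof -
  let ?S = "{x \<in> outer_strip L. c < content x \<and> content x \<le> r}"
  have d: "int (diag_len L k) - int (diag_len N k) = (if c < k \<and> k \<le> r then 1 else 0)" for k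
    by (rule diag_len_diff[OF L N(1), of "\<lambda>k. if c < k \<and> k \<le> r then 1 else 0" c])
      (use r c N(2) in auto)
  have dk: "1 \<le> diag_len L k" if "c < k" "k \<le> r" for k using d[of k] that by auto
  have NL: "N \<subseteq> L" unfolding young_subset_iff[OF L N(1)]
  proof
    fix k show "diag_len N k \<le> diag_len L k" using d[of k] by (auto split: if_splits)
  qed
  have S: "?S = L - N"
  proof (intro Set.set_eqI)
    fix x
    obtain s where s: "x = diag_cell (content x) s" using diag_cell_cases by blast
    have "diag_cell k s \<in> ?S \<longleftrightarrow> diag_cell k s \<in> L - N" for k
      using d[of k] by (auto simp: outer_strip_iff[OF L] diag_cell_mem_iff[OF L] diag_cell_mem_iff[OF N(1)]
          split: if_splits)
    then show "x \<in> ?S \<longleftrightarrow> x \<in> L - N" using s by metis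
  qed
  have fin: "finite ?S" using S young_finite[OF L] by simp
  define s where "s = diag_len L (c + 1)"
  define e where "e = diag_len L r"
  have sS: "diag_cell (c + 1) s \<in> ?S" and eS: "diag_cell r e \<in> ?S"
    using dk c by (auto simp: outer_strip_iff[OF L] s_def e_def)
  obtain r1 c1 where s1: "diag_cell (c + 1) s = (r1, c1)" by (cases "diag_cell (c + 1) s")
  obtain r2 c2 where e1: "diag_cell r e = (r2, c2)" by (cases "diag_cell r e")
  have ct: "content (r1, c1) = c + 1" "content (r2, c2) = r"
    using s1 e1 content_diag_cell by metis+
  have below: "(r1 + 1, c1) \<notin> L"
    using s1 diag_len_Suc[OF L, of c] c(1) unfolding young_mem_iff[OF L]
    by (auto simp: diag_cell_def s_def min_def split: if_splits)
  have right: "(r2, c2 + 1) \<notin> L"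
    using e1 diag_len_Suc[OF L, of r] r unfolding young_mem_iff[OF L]
    by (auto simp: diag_cell_def e_def min_def add.commute[of 1 r] split: if_splits)
  have "r2 \<le> i" "c1 \<le> j" if "(i, j) \<in> ?S" for i j
    using outer_strip_monotone[OF L, of i j r2 c2] outer_strip_monotone[OF L, of r1 c1 i j]
      that sS[unfolded s1] eS[unfolded e1] ct by auto
  then have "\<And>x. x \<in> ?S \<Longrightarrow> r2 \<le> fst x \<and> c1 \<le> snd x" by (metis prod.collapse)
  moreover have "?S \<noteq> {}" using sS by blast
  ultimately have mn: "r2 \<le> Min (fst ` ?S)" "c1 \<le> Min (snd ` ?S)"
    using fin by simp_all
  \<comment> \<open>A cell of the bounding quadrant with content outside this range would force a
    cell excluded by \<open>below\<close> or \<open>right\<close> into \<open>L\<close>; inside the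
    range it is dominated by the strip cell on its own diagonal.\<close>
  have "\<exists>i' j'. (i', j') \<in> ?S \<and> i \<le> i' \<and> j \<le> j'"
    if ij: "(i, j) \<in> L" "Min (fst ` ?S) \<le> i" "Min (snd ` ?S) \<le> j" for i j
  proof -
    have ge: "r2 \<le> i" "c1 \<le> j" using mn ij by auto
    have "content (i, j) \<le> r"
    proof (rule ccontr)
      assume "\<not> content (i, j) \<le> r"
      then have "c2 + 1 \<le> j" using ge ct by (auto simp: content_def)
      then show False using right young_down[OF L ij(1), of r2 "c2 + 1"] ge
          young_pos[OF L, of r2 c2] eS e1 by (auto simp: outer_strip_def)
    qed
    moreover have "c < content (i, j)"
    proof (rule ccontr)
      assume "\<not> c < content (i, j)"
      then have "r1 + 1 \<le> i" using ge ct by (auto simp: content_def)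
      then show False using below young_down[OF L ij(1), of "r1 + 1" c1] ge
          young_pos[OF L, of r1 c1] sS s1 by (auto simp: outer_strip_def)
    qed
    ultimately obtain k where ck: "c < k" "k \<le> r" "k = content (i, j)" by blast
    define t where "t = min i j"
    have k: "(i, j) = diag_cell k t" unfolding ck(3) t_def by (rule diag_cell_content[symmetric])
    have "t \<le> diag_len L k" using ij(1) unfolding k diag_cell_mem_iff[OF L] by simp
    moreover have "diag_cell k (diag_len L k) \<in> ?S"
      using ck(1,2) dk[OF ck(1,2)] by (simp add: outer_strip_iff[OF L])
    ultimately show ?thesis using k unfolding diag_cell_def
      by (intro exI[of _ "diag_len L k + nat (- k)"] exI[of _ "diag_len L k + nat k"]) auto
  qed
  moreover have "?S \<noteq> {}" using sS by blast
  ultimately show ?thesis by (intro strip_excited_eq[OF L N(1) NL S])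
qed

section \<open>The Lascoux--Pragacz decomposition\<close>

text \<open>Peeling drops the last cell of each diagonal, so \<open>t\<close> peelings amount to a
  shift by \<open>t\<close> along the diagonals, and shifts preserve Young diagrams.\<close>

lemma young_peeled:
  assumes L: "young (diagram lam)"
  shows "young (peeled lam t)" "diag_len (peeled lam t) k = diag_len (diagram lam) k - t"
proof -
  have mem: "diag_cell k s \<in> peeled lam t \<longleftrightarrow> 1 \<le> s \<and> s + t \<le> diag_len (diagram lam) k" for k s
  proof (induction t arbitrary: s)
    case 0
    then show ?case by (simp add: diag_cell_mem_iff[OF L])
  next
    case (Suc t)
    have "diag_cell k s \<in> outer_strip (peeled lam t) \<longleftrightarrow>
        diag_cell k s \<in> peeled lam t \<and> diag_cell k (s + 1) \<notin> peeled lam t"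
      by (simp add: outer_strip_def diag_cell_def)
    then show ?case by (auto simp: Suc.IH)
  qed
  have eq: "peeled lam t = shift_back t t (diagram lam)"
  proof (intro Set.set_eqI)
    fix x
    obtain k s where x: "x = diag_cell k s" using diag_cell_cases by blast
    have "diag_cell k s \<in> shift_back t t (diagram lam) \<longleftrightarrow>
        1 \<le> s + nat (- k) \<and> 1 \<le> s + nat k \<and> diag_cell k (s + t) \<in> diagram lam"
      by (simp add: shift_back_def diag_cell_def add_ac)
    also have "\<dots> \<longleftrightarrow> 1 \<le> s \<and> s + t \<le> diag_len (diagram lam) k"
      by (auto simp: diag_cell_mem_iff[OF L])
    finally show "x \<in> peeled lam t \<longleftrightarrow> x \<in> shift_back t t (diagram lam)"
      unfolding x mem by simp
  qed
  show Y: "young (peeled lam t)" unfolding eq by (rule young_shift_back[OF L])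
  have "1 \<le> s \<and> s \<le> diag_len (peeled lam t) k \<longleftrightarrow> 1 \<le> s \<and> s \<le> diag_len (diagram lam) k - t" for s
    using mem[of k s] diag_cell_mem_iff[OF Y, of k s] by auto
  from this[of "diag_len (peeled lam t) k"] this[of "diag_len (diagram lam) k - t"]
  show "diag_len (peeled lam t) k = diag_len (diagram lam) k - t"
    by linarith
qed

lemma start_content_eq:
  assumes P: "young P" and \<theta>: "\<theta> \<subseteq> outer_strip P" and x: "x \<in> \<theta>"
    and le: "\<And>y. y \<in> \<theta> \<Longrightarrow> content x \<le> content y"
  shows "start_content \<theta> = content x"
proof -
  have "starting_point \<theta> = x"
    unfolding starting_point_def
  proof (rule the_equality)
    show "x \<in> \<theta> \<and> (\<forall>d\<in>\<theta>. fst d \<le> fst x \<and> snd x \<le> snd d)"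
    proof (intro conjI ballI x)
      fix d assume "d \<in> \<theta>"
      then have "(fst x, snd x) \<in> outer_strip P" "(fst d, snd d) \<in> outer_strip P"
        "content (fst x, snd x) \<le> content (fst d, snd d)" using \<theta> x le by auto
      from outer_strip_monotone[OF P this]
      show "fst d \<le> fst x" "snd x \<le> snd d" .
    qed
    then show "c = x" if "c \<in> \<theta> \<and> (\<forall>d\<in>\<theta>. fst d \<le> fst c \<and> snd c \<le> snd d)" for c
      using that x by (metis order_antisym prod_eq_iff)
  qed
  then show ?thesis by (simp add: start_content_def)
qed

lemma end_content_eq:
  assumes P: "young P" and \<theta>: "\<theta> \<subseteq> outer_strip P" and x: "x \<in> \<theta>"
    and le: "\<And>y. y \<in> \<theta> \<Longrightarrow> content y \<le> content x"
  shows "end_content \<theta> = content x"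
proof -
  have "ending_point \<theta> = x"
    unfolding ending_point_def
  proof (rule the_equality)
    show "x \<in> \<theta> \<and> (\<forall>d\<in>\<theta>. fst x \<le> fst d \<and> snd d \<le> snd x)"
    proof (intro conjI ballI x)
      fix d assume "d \<in> \<theta>"
      then have "(fst d, snd d) \<in> outer_strip P" "(fst x, snd x) \<in> outer_strip P"
        "content (fst d, snd d) \<le> content (fst x, snd x)" using \<theta> x le by auto
      from outer_strip_monotone[OF P this]
      show "fst x \<le> fst d" "snd d \<le> snd x" .
    qed
    then show "c = x" if "c \<in> \<theta> \<and> (\<forall>d\<in>\<theta>. fst c \<le> fst d \<and> snd d \<le> snd c)" for c
      using that x by (metis order_antisym prod_eq_iff)
  qed
  then show ?thesis by (simp add: end_content_def)
qed

section \<open>Contents along paths of cells\<close>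

lemma adjacent_content:
  assumes "adjacent c d"
  shows "content d = content c + 1 \<or> content c = content d + 1"
  using assms unfolding adjacent_def content_def by arith

lemma linked_sym: "(c, d) \<in> linked S \<Longrightarrow> (d, c) \<in> linked S"
proof -
  have "sym {(c, d). c \<in> S \<and> d \<in> S \<and> adjacent c d}"
    by (auto simp: sym_def adjacent_def abs_minus_commute)
  then show "(c, d) \<in> linked S \<Longrightarrow> (d, c) \<in> linked S"
    unfolding linked_def by (rule symD[OF sym_rtrancl])
qed

text \<open>A discrete intermediate value theorem: content changes by 1 at each step of a
  path.\<close>

lemma linked_contents:
  assumes "(c, d) \<in> linked S" "c \<in> S"
  shows "d \<in> S \<and> {min (content c) (content d)..max (content c) (content d)} \<subseteq> content ` S"
  using assms unfolding linked_def
proof (induction rule: rtrancl_induct)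
  case base
  then show ?case by auto
next
  case (step y z)
  then have IH: "y \<in> S" "{min (content c) (content y)..max (content c) (content y)} \<subseteq> content ` S"
    and z: "z \<in> S" "adjacent y z" by auto
  show ?case
  proof (intro conjI subsetI)
    fix k assume k: "k \<in> {min (content c) (content z)..max (content c) (content z)}"
    have "k \<in> {min (content c) (content y)..max (content c) (content y)} \<or> k = content z"
      using k adjacent_content[OF z(2)] by auto
    then show "k \<in> content ` S" using IH(2) z(1) by blast
  qed (rule z(1))
qed

section \<open>Strips as intervals of contents\<close>

locale skew_shape =
  fixes lam :: "nat list" and L M :: "cell set"
  assumes lam: "diagram lam = L" and yL: "young L" and yM: "young M" and sub: "M \<subseteq> L"
begin

definition layer :: "nat \<Rightarrow> cell set" where
  "layer t = outer_strip (peeled lam t) - M"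

text \<open>A superlevel set of the depth \<open>diag_len L k - diag_len M k\<close>, in additive
  form to avoid truncated subtraction.\<close>

definition layer_contents :: "nat \<Rightarrow> int set" where
  "layer_contents t = {k. diag_len M k + t < diag_len L k}"

text \<open>The last cell of diagonal \<open>k\<close> after \<open>t\<close> peelings; for
  \<open>k\<close> in \<open>layer_contents t\<close> the subtraction does not truncate.\<close>

definition layer_cell :: "nat \<Rightarrow> int \<Rightarrow> cell" where
  "layer_cell t k = diag_cell k (diag_len L k - t)"

lemma young_peeled': "young (peeled lam t)" "diag_len (peeled lam t) k = diag_len L k - t"
  using young_peeled lam yL by auto

lemma diag_len_inner_le: "diag_len M k \<le> diag_len L k"
  using diag_len_mono[OF yL sub] .

lemma content_layer_cell [simp]: "content (layer_cell t k) = k"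
  by (simp add: layer_cell_def)

lemma layer_cell_inject [simp]: "layer_cell t k = layer_cell t k' \<longleftrightarrow> k = k'"
  by (metis content_layer_cell)

lemma layer_eq: "layer t = layer_cell t ` layer_contents t"
proof (intro Set.set_eqI)
  fix x
  obtain k s where x: "x = diag_cell k s" using diag_cell_cases by blast
  have "x \<in> layer t \<longleftrightarrow> 1 \<le> s \<and> s = diag_len L k - t \<and> diag_len M k < s"
    unfolding x layer_def
    by (auto simp: outer_strip_iff[OF young_peeled'(1)] young_peeled'(2) diag_cell_mem_iff[OF yM])
  also have "\<dots> \<longleftrightarrow> x \<in> layer_cell t ` layer_contents t"
    by (auto simp: x layer_cell_def layer_contents_def image_iff)
  finally show "x \<in> layer t \<longleftrightarrow> x \<in> layer_cell t ` layer_contents t" .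
qed

lemma layer_cell_mem [simp]: "layer_cell t k \<in> layer t \<longleftrightarrow> k \<in> layer_contents t"
  by (auto simp: layer_eq)

lemma content_layer: "content ` layer t = layer_contents t"
  by (auto simp: layer_eq image_iff)

lemma adjacent_layer_cells:
  assumes "k \<in> layer_contents t" "k + 1 \<in> layer_contents t"
  shows "adjacent (layer_cell t k) (layer_cell t (k + 1))"
proof -
  have "t < diag_len L k" "t < diag_len L (k + 1)" using assms by (auto simp: layer_contents_def)
  then show ?thesis using diag_len_Suc[OF yL, of k]
    by (cases "k < 0") (auto simp: adjacent_def layer_cell_def diag_cell_def split: if_splits)
qed

lemma linked_layer_cells:
  assumes "k \<le> k'" "{k..k'} \<subseteq> layer_contents t"
  shows "(layer_cell t k, layer_cell t k') \<in> linked (layer t)"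
  using assms
proof (induction k' rule: int_ge_induct)
  case base
  then show ?case by (simp add: linked_def)
next
  case (step k')
  have "(layer_cell t k, layer_cell t k') \<in> linked (layer t)"
    by (rule step.IH) (use step.prems in auto)
  moreover have "k' \<in> layer_contents t" "k' + 1 \<in> layer_contents t" using step.hyps step.prems by auto
  ultimately show ?case using adjacent_layer_cells unfolding linked_def
    by (elim rtrancl_into_rtrancl) auto
qed

definition lp_interval :: "nat \<Rightarrow> int \<Rightarrow> int \<Rightarrow> bool" where
  "lp_interval t p q \<longleftrightarrow> p \<le> q \<and> {p..q} \<subseteq> layer_contents t \<and>
     p - 1 \<notin> layer_contents t \<and> q + 1 \<notin> layer_contents t"

lemma finite_layer_contents: "finite (layer_contents t)"
proof -
  have "layer_contents t \<subseteq> content ` L"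
  proof
    fix k assume "k \<in> layer_contents t"
    then have "diag_cell k (diag_len L k) \<in> L"
      unfolding diag_cell_mem_iff[OF yL] by (auto simp: layer_contents_def)
    then show "k \<in> content ` L" by (metis content_diag_cell image_eqI)
  qed
  then show ?thesis using young_finite[OF yL] finite_subset by blast
qed

lemma lp_interval_exists:
  assumes "k \<in> layer_contents t"
  obtains p q where "lp_interval t p q" "p \<le> k" "k \<le> q"
proof -
  let ?P = "{p. p \<le> k \<and> {p..k} \<subseteq> layer_contents t}"
  let ?Q = "{q. k \<le> q \<and> {k..q} \<subseteq> layer_contents t}"
  have "?P \<subseteq> layer_contents t" "?Q \<subseteq> layer_contents t" by auto
  then have fin: "finite ?P" "finite ?Q" using finite_layer_contents finite_subset by blast+
  have ne: "k \<in> ?P" "k \<in> ?Q" using assms by auto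
  define p q where "p = Min ?P" and "q = Max ?Q"
  have p: "p \<in> ?P" and q: "q \<in> ?Q" using Min_in[OF fin(1)] Max_in[OF fin(2)] ne
    unfolding p_def q_def by blast+
  have "p - 1 \<notin> ?P" using Min_le[OF fin(1), of "p - 1"] unfolding p_def by linarith
  moreover have "{p - 1..k} = insert (p - 1) {p..k}" using p by auto
  ultimately have p1: "p - 1 \<notin> layer_contents t" using p by auto
  have "q + 1 \<notin> ?Q" using Max_ge[OF fin(2), of "q + 1"] unfolding q_def by linarith
  moreover have "{k..q + 1} = insert (q + 1) {k..q}" using q by auto
  ultimately have q1: "q + 1 \<notin> layer_contents t" using q by auto
  have "{p..q} \<subseteq> {p..k} \<union> {k..q}" by auto
  then have "lp_interval t p q" unfolding lp_interval_def using p q p1 q1 by auto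
  then show ?thesis using that p q by blast
qed

text \<open>Consecutive contents give adjacent layer cells, so the interval is linked; a path
  leaving it would pass through one of the missing contents \<open>p - 1\<close> and
  \<open>q + 1\<close>.\<close>

lemma component_eq:
  assumes pq: "lp_interval t p q" and k: "p \<le> k" "k \<le> q"
  shows "linked (layer t) `` {layer_cell t k} = layer_cell t ` {p..q}"
proof (intro equalityI subsetI)
  have kt: "k \<in> layer_contents t" using pq k by (auto simp: lp_interval_def)
  fix x assume "x \<in> linked (layer t) `` {layer_cell t k}"
  then have "(layer_cell t k, x) \<in> linked (layer t)" by simp
  from linked_contents[OF this] kt
  have x: "x \<in> layer t" "{min k (content x)..max k (content x)} \<subseteq> layer_contents t"
    by (auto simp: content_layer)
  then obtain k' where k': "x = layer_cell t k'" "k' \<in> layer_contents t" by (auto simp: layer_eq)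
  have "p \<le> k'"
  proof (rule ccontr)
    assume "\<not> p \<le> k'"
    then have "p - 1 \<in> {min k (content x)..max k (content x)}" using k k'(1) by auto
    then show False using x(2) pq unfolding lp_interval_def by blast
  qed
  moreover have "k' \<le> q"
  proof (rule ccontr)
    assume "\<not> k' \<le> q"
    then have "q + 1 \<in> {min k (content x)..max k (content x)}" using k k'(1) by auto
    then show False using x(2) pq unfolding lp_interval_def by blast
  qed
  ultimately show "x \<in> layer_cell t ` {p..q}" using k'(1) by auto
next
  fix x assume "x \<in> layer_cell t ` {p..q}"
  then obtain k' where k': "x = layer_cell t k'" "p \<le> k'" "k' \<le> q" by auto
  have "{k..k'} \<subseteq> {p..q}" "{k'..k} \<subseteq> {p..q}" using k k' by auto
  then have s: "{k..k'} \<subseteq> layer_contents t" "{k'..k} \<subseteq> layer_contents t"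
    using pq unfolding lp_interval_def by blast+
  have "(layer_cell t k, x) \<in> linked (layer t)"
  proof (cases "k \<le> k'")
    case True
    then show ?thesis using linked_layer_cells[OF True s(1)] k'(1) by simp
  next
    case False
    then show ?thesis using linked_sym[OF linked_layer_cells[OF _ s(2)]] k'(1) by simp
  qed
  then show "x \<in> linked (layer t) `` {layer_cell t k}" by simp
qed

lemma components_layer: "components (layer t) = {layer_cell t ` {p..q} | p q. lp_interval t p q}"
proof (intro equalityI subsetI)
  fix \<theta> assume "\<theta> \<in> components (layer t)"
  then obtain k where k: "k \<in> layer_contents t" "\<theta> = linked (layer t) `` {layer_cell t k}"
    unfolding components_def layer_eq by (auto elim!: quotientE)
  obtain p q where "lp_interval t p q" "p \<le> k" "k \<le> q" using lp_interval_exists[OF k(1)] by blast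
  then show "\<theta> \<in> {layer_cell t ` {p..q} | p q. lp_interval t p q}" using component_eq k(2) by blast
next
  fix \<theta> assume "\<theta> \<in> {layer_cell t ` {p..q} | p q. lp_interval t p q}"
  then obtain p q where pq: "\<theta> = layer_cell t ` {p..q}" "lp_interval t p q" by blast
  then have p: "p \<le> q" "layer_cell t p \<in> layer t" by (auto simp: lp_interval_def)
  then have "\<theta> = linked (layer t) `` {layer_cell t p}" using component_eq[OF pq(2), of p] pq(1) by simp
  then show "\<theta> \<in> components (layer t)" using p unfolding components_def by (auto intro: quotientI)
qed

lemma strip_contents:
  assumes "lp_interval t p q"
  shows "start_content (layer_cell t ` {p..q}) = p" "end_content (layer_cell t ` {p..q}) = q"
proof -
  have sub: "layer_cell t ` {p..q} \<subseteq> outer_strip (peeled lam t)" and "p \<le> q"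
    using assms layer_eq[of t] by (auto simp: lp_interval_def layer_def)
  have "p \<le> content y" "content y \<le> q" if "y \<in> layer_cell t ` {p..q}" for y
    using that by auto
  then show "start_content (layer_cell t ` {p..q}) = p" "end_content (layer_cell t ` {p..q}) = q"
    using start_content_eq[OF young_peeled'(1) sub, of "layer_cell t p"]
      end_content_eq[OF young_peeled'(1) sub, of "layer_cell t q"] \<open>p \<le> q\<close> by simp_all
qed

text \<open>The depth rises from \<open>t\<close> to \<open>t + 1\<close> on entering the interval
  and falls back on leaving it. Its step from \<open>k\<close> to \<open>k + 1\<close> goes up
  exactly for \<open>k\<close> in \<open>maya M - maya L\<close> and down exactly for
  \<open>k\<close> in \<open>maya L - maya M\<close>. Steps are labelled by their left end, hence
  \<open>p - 1\<close> but \<open>q\<close>.\<close>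

lemma lp_interval_maya:
  assumes "lp_interval t p q"
  shows "int t = int (diag_len L (p - 1)) - int (diag_len M (p - 1))"
    and "int t = int (diag_len L (q + 1)) - int (diag_len M (q + 1))"
    and "p - 1 \<in> maya M - maya L" and "q \<in> maya L - maya M"
proof -
  have p: "diag_len M p + t < diag_len L p" and q: "diag_len M q + t < diag_len L q"
    and p': "\<not> diag_len M (p - 1) + t < diag_len L (p - 1)"
    and q': "\<not> diag_len M (q + 1) + t < diag_len L (q + 1)"
    using assms by (auto simp: lp_interval_def layer_contents_def)
  show "int t = int (diag_len L (p - 1)) - int (diag_len M (p - 1))" "p - 1 \<in> maya M - maya L"
    using p p' diag_len_pred[OF yL, of p] diag_len_pred[OF yM, of p] by (auto split: if_splits)
  show "int t = int (diag_len L (q + 1)) - int (diag_len M (q + 1))" "q \<in> maya L - maya M"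
    using q q' diag_len_Suc[OF yL, of q] diag_len_Suc[OF yM, of q] by (auto split: if_splits)
qed

text \<open>The level is the depth at \<open>c\<close>, just before the upward step; at this level
  the interval around \<open>c + 1\<close> cannot extend to \<open>c\<close>.\<close>

lemma lp_interval_start:
  assumes "c \<in> maya M - maya L"
  obtains t q where "lp_interval t (c + 1) q"
proof -
  define t where "t = diag_len L c - diag_len M c"
  have c: "c \<notin> layer_contents t" "c + 1 \<in> layer_contents t"
    using assms diag_len_Suc[OF yL, of c] diag_len_Suc[OF yM, of c] diag_len_inner_le[of c]
    by (auto simp: layer_contents_def t_def)
  obtain p q where pq: "lp_interval t p q" "p \<le> c + 1" "c + 1 \<le> q"
    using lp_interval_exists[OF c(2)] by blast
  have "p = c + 1"
  proof (rule ccontr)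
    assume "p \<noteq> c + 1"
    then have "c \<in> {p..q}" using pq by auto
    then show False using c(1) pq(1) unfolding lp_interval_def by blast
  qed
  then show ?thesis using that pq(1) by blast
qed

lemma lp_interval_end:
  assumes "r \<in> maya L - maya M"
  obtains t p where "lp_interval t p r"
proof -
  define t where "t = diag_len L (r + 1) - diag_len M (r + 1)"
  have c: "r + 1 \<notin> layer_contents t" "r \<in> layer_contents t"
    using assms diag_len_Suc[OF yL, of r] diag_len_Suc[OF yM, of r] diag_len_inner_le[of "r + 1"]
    by (auto simp: layer_contents_def t_def)
  obtain p q where pq: "lp_interval t p q" "p \<le> r" "r \<le> q"
    using lp_interval_exists[OF c(2)] by blast
  have "q = r"
  proof (rule ccontr)
    assume "q \<noteq> r"
    then have "r + 1 \<in> {p..q}" using pq by auto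
    then show False using c(1) pq(1) unfolding lp_interval_def by blast
  qed
  then show ?thesis using that pq(1) by blast
qed

text \<open>Superlevel sets are nested, so the interval of the higher level lies in the lower
  superlevel set, and maximality leaves only containment or separation. Intervals never abut,
  because ends \<open>q\<close> belong to \<open>maya L\<close> and positions \<open>p - 1\<close>
  do not.\<close>

lemma lp_interval_trichotomy:
  assumes a: "lp_interval t p q" and b: "lp_interval t' p' q'" and tt: "t \<le> t'"
  shows "q + 1 < p' \<or> q' + 1 < p \<or> p \<le> p' \<and> q' \<le> q"
proof (rule ccontr)
  have sub: "{p'..q'} \<subseteq> layer_contents t" using b tt by (auto simp: lp_interval_def layer_contents_def)
  assume n: "\<not> ?thesis"
  have dj: "p - 1 \<noteq> q'" "p' - 1 \<noteq> q"
    using lp_interval_maya(3,4)[OF a] lp_interval_maya(3,4)[OF b] by auto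
  have le: "p \<le> q" "p' \<le> q'" using a b by (auto simp: lp_interval_def)
  have "p' < p \<or> q < q'" using n by linarith
  then show False
  proof
    assume "p' < p"
    then have "p - 1 \<in> {p'..q'}" using n dj by auto
    then show False using sub a unfolding lp_interval_def by blast
  next
    assume "q < q'"
    then have "q + 1 \<in> {p'..q'}" using n dj by auto
    then show False using sub a unfolding lp_interval_def by blast
  qed
qed

lemma lp_interval_unique_start:
  assumes a: "lp_interval t p q" and b: "lp_interval t' p q'"
  shows "t = t'" "q = q'"
proof -
  show t: "t = t'" using lp_interval_maya(1)[OF a] lp_interval_maya(1)[OF b] by simp
  show "q = q'" using lp_interval_trichotomy[OF a b] lp_interval_trichotomy[OF b a] t a b
    by (auto simp: lp_interval_def)
qed

lemma lp_interval_unique_end: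
  assumes a: "lp_interval t p q" and b: "lp_interval t' p' q"
  shows "t = t'" "p = p'"
proof -
  show t: "t = t'" using lp_interval_maya(2)[OF a] lp_interval_maya(2)[OF b] by simp
  show "p = p'" using lp_interval_trichotomy[OF a b] lp_interval_trichotomy[OF b a] t a b
    by (auto simp: lp_interval_def)
qed

lemma layer_contents_0: "layer_contents 0 = content ` (L - M)"
proof (intro equalityI subsetI)
  fix k assume "k \<in> layer_contents 0"
  then have "layer_cell 0 k \<in> layer 0" by simp
  then have "layer_cell 0 k \<in> L - M" by (auto simp: layer_def outer_strip_def lam)
  then show "k \<in> content ` (L - M)" by (metis content_layer_cell image_eqI)
next
  fix k assume "k \<in> content ` (L - M)"
  then obtain x where x: "x \<in> L - M" "content x = k" by blast
  obtain s where "x = diag_cell k s" using diag_cell_cases x(2) by metis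
  then show "k \<in> layer_contents 0"
    using x(1) by (auto simp: diag_cell_mem_iff[OF yL] diag_cell_mem_iff[OF yM] layer_contents_def)
qed

text \<open>This makes the outermost layer of a connected shape a single strip.\<close>

lemma layer_contents_interval:
  assumes "cells_connected (L - M)" "k \<in> layer_contents 0" "k' \<in> layer_contents 0"
  shows "{k..k'} \<subseteq> layer_contents 0"
proof -
  obtain x y where "x \<in> L - M" "content x = k" "y \<in> L - M" "content y = k'"
    using assms(2,3) unfolding layer_contents_0 by blast
  then have "{min k k'..max k k'} \<subseteq> content ` (L - M)"
    using linked_contents[of x y "L - M"] assms(1) unfolding cells_connected_def by blast
  moreover have "{k..k'} \<subseteq> {min k k'..max k k'}" by auto
  ultimately show ?thesis unfolding layer_contents_0 by blast
qed

end

section \<open>Signs and determinants\<close>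

text \<open>The sign of the Vandermonde product of \<open>f\<close>; for injective \<open>f\<close>,
  the sign of the permutation that sorts it. It allows the columns of a minor to be listed in any
  order.\<close>

definition inv_sign :: "nat \<Rightarrow> (nat \<Rightarrow> int) \<Rightarrow> int" where
  "inv_sign n f = (\<Prod>(i, j)\<in>{(i, j). i < j \<and> j < n}. sgn (f j - f i))"

lemma finite_pairs: "finite {(i, j). i < j \<and> j < (n::nat)}"
  by (rule finite_subset[of _ "{..<n} \<times> {..<n}"]) auto

lemma inv_sign_cong: "(\<And>i. i < n \<Longrightarrow> f i = g i) \<Longrightarrow> inv_sign n f = inv_sign n g"
  unfolding inv_sign_def by (rule prod.cong) auto

lemma inv_sign_transpose_id:
  assumes "a < b" "b < n"
  shows "inv_sign n (\<lambda>i. int (transpose a b i)) = - 1"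
proof -
  let ?P = "{(i, j). i < j \<and> j < n}"
  \<comment> \<open>The inverted pairs: \<open>a\<close> with everything up to \<open>b\<close>, and
    \<open>b\<close> with everything strictly between, an odd number in total.\<close>
  let ?N = "{a} \<times> {a<..b} \<union> {a<..<b} \<times> {b}"
  have "inv_sign n (\<lambda>i. int (transpose a b i)) = (\<Prod>x\<in>?N. - 1)"
    unfolding inv_sign_def
  proof (rule prod.mono_neutral_cong_right[OF finite_pairs])
    show "?N \<subseteq> ?P" using assms by auto
    show "\<forall>x\<in>?P - ?N. (case x of (i, j) \<Rightarrow> sgn (int (transpose a b j) - int (transpose a b i))) = 1"
      using assms by (auto simp: transpose_def sgn_if split: if_splits)
    show "\<And>x. x \<in> ?N \<Longrightarrow> (case x of (i, j) \<Rightarrow> sgn (int (transpose a b j) - int (transpose a b i))) = - 1"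
      using assms by (auto simp: transpose_def sgn_if split: if_splits)
  qed
  also have "\<dots> = (- 1) ^ card ?N" by simp
  also have "card ?N = card ({a} \<times> {a<..b}) + card ({a<..<b} \<times> {b})"
    by (rule card_Un_disjoint) auto
  also have "\<dots> = 2 * (b - Suc a) + 1" using assms by simp
  finally show ?thesis by simp
qed

text \<open>The factor \<open>?w\<close> is symmetric, hence a function of unordered pairs. The
  involution \<tau> permutes these, and \<open>?h\<close> restores increasing order.\<close>

lemma inv_sign_comp:
  assumes f: "inj_on f {..<n}" and t: "\<tau> permutes {..<n}" "\<And>i. \<tau> (\<tau> i) = i"
  shows "inv_sign n (f \<circ> \<tau>) = inv_sign n (\<lambda>i. int (\<tau> i)) * inv_sign n f"
proof -
  let ?P = "{(i, j). i < j \<and> j < n}"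
  let ?h = "\<lambda>(i, j). if \<tau> i < \<tau> j then (\<tau> i, \<tau> j) else (\<tau> j, \<tau> i)"
  let ?w = "\<lambda>(i, j). sgn (f j - f i) * sgn (int j - int i)"
  have lt: "\<tau> i < n \<longleftrightarrow> i < n" for i using permutes_in_image[OF t(1), of i] by simp
  have ne: "\<tau> i = \<tau> j \<longleftrightarrow> i = j" for i j using t(2) by metis
  have "inv_sign n (f \<circ> \<tau>) =
      (\<Prod>x\<in>?P. (case x of (i, j) \<Rightarrow> sgn (int (\<tau> j) - int (\<tau> i))) * ?w (?h x))"
    unfolding inv_sign_def
  proof (rule prod.cong[OF refl])
    fix x assume "x \<in> ?P"
    then obtain i j where x: "x = (i, j)" "i < j" "j < n" by auto
    then have "\<tau> i \<noteq> \<tau> j" using ne by auto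
    then show "(case x of (i, j) \<Rightarrow> sgn ((f \<circ> \<tau>) j - (f \<circ> \<tau>) i)) =
        (case x of (i, j) \<Rightarrow> sgn (int (\<tau> j) - int (\<tau> i))) * ?w (?h x)"
      unfolding x(1) by (auto simp: sgn_if)
  qed
  also have "\<dots> = inv_sign n (\<lambda>i. int (\<tau> i)) * (\<Prod>x\<in>?P. ?w (?h x))"
    by (simp add: prod.distrib inv_sign_def)
  also have "(\<Prod>x\<in>?P. ?w (?h x)) = (\<Prod>x\<in>?P. ?w x)"
    by (rule prod.reindex_bij_witness[of _ ?h ?h])
      (auto simp: t(2) lt ne split: if_splits dest: less_trans simp: not_less order.order_iff_strict)
  also have "\<dots> = inv_sign n f"
    unfolding inv_sign_def by (rule prod.cong) auto
  finally show ?thesis .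
qed

lemma inv_sign_permutes:
  assumes "\<pi> permutes {..<n}"
  shows "inv_sign n (\<lambda>i. int (\<pi> i)) = sign \<pi>"
  using finite_lessThan assms
proof (induction rule: permutes_rev_induct)
  case id
  show ?case unfolding inv_sign_def by (auto intro!: prod.neutral)
next
  case (swap a b p)
  define a' b' where "a' = min a b" and "b' = max a b"
  have ab: "a' < b'" "b' < n" "transpose a b = transpose a' b'"
    using swap.hyps by (auto simp: a'_def b'_def min_def max_def transpose_commute)
  have inj: "inj_on (\<lambda>i. int (p i)) {..<n}"
    using permutes_inj[OF \<open>p permutes {..<n}\<close>] by (auto simp: inj_on_def inj_def)
  have tp: "transpose a' b' permutes {..<n}" using ab by (intro permutes_swap_id) auto
  have "inv_sign n ((\<lambda>i. int (p i)) \<circ> transpose a' b') = - sign p"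
    using inv_sign_comp[OF inj tp] inv_sign_transpose_id[OF ab(1,2)] swap.IH by simp
  moreover have "sign (p \<circ> transpose a' b') = - sign p"
    using sign_compose[of p "transpose a' b'"] ab tp \<open>p permutes {..<n}\<close>
    by (auto simp: sign_swap_id permutation_permutes)
  ultimately show ?case by (simp add: ab(3) o_def)
qed

text \<open>No other value lies at \<open>k - 1\<close> or \<open>k\<close>, so the change affects
  no comparison.\<close>

lemma inv_sign_neighbour:
  assumes "j0 < n" "f j0 = k" "\<And>j. j < n \<Longrightarrow> j \<noteq> j0 \<Longrightarrow> f j \<noteq> k - 1 \<and> f j \<noteq> k"
  shows "inv_sign n (f(j0 := k - 1)) = inv_sign n f"
  unfolding inv_sign_def
proof (rule prod.cong[OF refl], clarify)
  fix i j assume ij: "i < j" "j < n"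
  show "sgn ((f(j0 := k - 1)) j - (f(j0 := k - 1)) i) = sgn (f j - f i)"
    using assms(2) assms(3)[of i] assms(3)[of j] ij by (auto simp: sgn_if)
qed

lemma inv_sign_square:
  assumes "inj_on f {..<n}"
  shows "inv_sign n f * inv_sign n f = 1"
  unfolding inv_sign_def prod.distrib[symmetric]
proof (rule prod.neutral, clarify)
  fix i j assume "i < j" "j < n"
  then have "f i \<noteq> f j" using assms by (auto dest: inj_onD)
  then show "(sgn (f j - f i)) * (sgn (f j - f i)) = 1" by (auto simp: sgn_if)
qed

section \<open>Determinants under changes of columns\<close>

lemma det_column_expand:
  assumes "j < n" "\<And>i l. i < n \<Longrightarrow> l < n \<Longrightarrow> l \<noteq> j \<Longrightarrow> B i l = C i l"
  shows "det (mat n n (\<lambda>(i, l). if l = j then w i else B i l)) =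
    (\<Sum>i<n. w i * cofactor (mat n n (\<lambda>(i, l). C i l)) i j)"
proof -
  let ?B = "mat n n (\<lambda>(i, l). if l = j then w i else B i l)"
  have "cofactor ?B i j = cofactor (mat n n (\<lambda>(i, l). C i l)) i j" if "i < n" for i
  proof -
    have "mat_delete ?B i j = mat_delete (mat n n (\<lambda>(i, l). C i l)) i j"
      by (rule eq_matI) (use assms that in \<open>auto simp: mat_delete_def\<close>)
    then show ?thesis by (simp add: cofactor_def)
  qed
  then show ?thesis
    by (subst laplace_expansion_column[of _ n j]) (use assms(1) in auto)
qed

lemma det_column_add:
  fixes B :: "nat \<Rightarrow> nat \<Rightarrow> 'a :: comm_ring_1"
  assumes "j < n"
  shows "det (mat n n (\<lambda>(i, l). if l = j then u i + v i else B i l)) =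
    det (mat n n (\<lambda>(i, l). if l = j then u i else B i l)) +
    det (mat n n (\<lambda>(i, l). if l = j then v i else B i l))"
  unfolding det_column_expand[OF assms refl] by (simp add: sum.distrib algebra_simps)

lemma det_column_0:
  fixes B :: "nat \<Rightarrow> nat \<Rightarrow> 'a :: comm_ring_1"
  assumes "j < n" "\<And>i. i < n \<Longrightarrow> B i j = 0"
  shows "det (mat n n (\<lambda>(i, l). B i l)) = 0"
  by (subst laplace_expansion_column[of _ n j]) (use assms in auto)

lemma det_columns_eq:
  fixes B :: "nat \<Rightarrow> nat \<Rightarrow> 'a :: comm_ring_1"
  assumes "j < n" "l < n" "j \<noteq> l" "\<And>i. i < n \<Longrightarrow> B i j = B i l"
  shows "det (mat n n (\<lambda>(i, l). B i l)) = 0"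
  by (rule det_identical_columns[of _ n j l]) (use assms in \<open>auto intro!: eq_vecI\<close>)

text \<open>Cramer's rule for \<open>X\<close> with \<open>P * X = Q\<close>. Columns shared by
  \<open>P\<close> and \<open>Q\<close> become unit vectors in \<open>X\<close>, so \<open>X\<close>
  is block lower triangular and its determinant is that of the leading block.\<close>

lemma det_replace_columns:
  fixes P Q :: "int mat"
  assumes P: "P \<in> carrier_mat n n" and Q: "Q \<in> carrier_mat n n" and K: "K \<le> n"
    and same: "\<And>j. K \<le> j \<Longrightarrow> j < n \<Longrightarrow> col Q j = col P j" and unit: "det P * det P = 1"
  shows "det Q = det P * det (mat K K (\<lambda>(a, b). det P * det (replace_col P (col Q b) a)))"
proof -
  define d where "d = det P"
  \<comment> \<open>As \<open>det P\<close> is 1 or -1, this is the inverse of \<open>P\<close>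
    times \<open>Q\<close>, with integer entries.\<close>
  define X where "X = d \<cdot>\<^sub>m (adj_mat P * Q)"
  note adj = adj_mat[OF P]
  have X: "X \<in> carrier_mat n n" using adj(1) Q by (auto simp: X_def)
  have "P * X = d \<cdot>\<^sub>m (P * (adj_mat P * Q))"
    unfolding X_def by (rule mult_smult_distrib[OF P mult_carrier_mat[OF adj(1) Q]])
  also have "P * (adj_mat P * Q) = (d \<cdot>\<^sub>m 1\<^sub>m n) * Q"
    using assoc_mult_mat[OF P adj(1) Q] adj(2) by (simp add: d_def)
  also have "\<dots> = d \<cdot>\<^sub>m Q"
    using mult_smult_assoc_mat[OF one_carrier_mat Q] Q by simp
  also have "d \<cdot>\<^sub>m (d \<cdot>\<^sub>m Q) = Q"
    using unit by (auto simp: d_def mult.assoc[symmetric])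
  finally have PX: "P * X = Q" .
  have entry: "X $$ (a, b) = d * det (replace_col P (col Q b) a)" if "a < n" "b < n" for a b
  proof -
    have "P *\<^sub>v col X b = col Q b" using PX P X that by (metis col_mult2)
    then have "det (replace_col P (col Q b) a) = X $$ (a, b) * d"
      using cramer_lemma_mat[OF P _ that(1), of "col X b"] X that by (simp add: d_def)
    then show ?thesis using unit by (simp add: d_def algebra_simps)
  qed
  have right: "X $$ (a, b) = (if a = b then 1 else 0)" if "a < n" "K \<le> b" "b < n" for a b
  proof (cases "a = b")
    case True
    have "replace_col P (col P b) b = P" using P that by (intro eq_matI) (auto simp: replace_col_def)
    then show ?thesis using entry[OF that(1,3)] same[OF that(2,3)] True unit by (simp add: d_def)
  next
    case False
    have "det (replace_col P (col P b) a) = 0"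
      by (rule det_identical_columns[of _ n a b])
        (use P that False in \<open>auto simp: replace_col_def intro!: eq_vecI\<close>)
    then show ?thesis using entry[OF that(1,3)] same[OF that(2,3)] False by simp
  qed
  let ?A1 = "mat K K (\<lambda>(a, b). X $$ (a, b))" and ?A3 = "mat (n - K) K (\<lambda>(a, b). X $$ (a + K, b))"
  have "X = four_block_mat ?A1 (0\<^sub>m K (n - K)) ?A3 (1\<^sub>m (n - K))"
    by (rule eq_matI) (use X K right in \<open>auto simp: four_block_mat_def\<close>)
  then have "det X = det ?A1 * det (1\<^sub>m (n - K) :: int mat)"
    by (metis (no_types, lifting) det_four_block_mat_upper_right_zero mat_carrier one_carrier_mat)
  moreover have "?A1 = mat K K (\<lambda>(a, b). det P * det (replace_col P (col Q b) a))"
    by (rule eq_matI) (use K entry in \<open>auto simp: d_def\<close>)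
  moreover have "det Q = det P * det X" using det_mult[OF P X] PX by simp
  ultimately show ?thesis by simp
qed

lemma det_scale_rows_cols:
  fixes E :: "nat \<Rightarrow> nat \<Rightarrow> 'a :: comm_ring_1"
  shows "det (mat n n (\<lambda>(i, j). u i * v j * E i j)) =
    (\<Prod>i<n. u i) * (\<Prod>j<n. v j) * det (mat n n (\<lambda>(i, j). E i j))"
proof -
  have *: "(\<Prod>i = 0..<n. u i * v (p i) * E i (p i)) =
      (\<Prod>i<n. u i) * (\<Prod>j<n. v j) * (\<Prod>i = 0..<n. E i (p i))" if "p permutes {0..<n}" for p
  proof -
    have "(\<Prod>i = 0..<n. v (p i)) = (\<Prod>j = 0..<n. v j)"
      using prod.permute[OF that, of v] by (simp add: o_def)
    then show ?thesis by (simp add: prod.distrib atLeast0LessThan)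
  qed
  have "det (mat n n (\<lambda>(i, j). u i * v j * E i j)) =
     (\<Sum>p | p permutes {0..<n}. signof p * ((\<Prod>i<n. u i) * (\<Prod>j<n. v j) *
        (\<Prod>i = 0..<n. E i (p i))))"
    by (subst det_def'[of _ n]) (auto intro!: sum.cong simp: *)
  also have "\<dots> = (\<Prod>i<n. u i) * (\<Prod>j<n. v j) * det (mat n n (\<lambda>(i, j). E i j))"
    by (subst det_def'[of _ n]) (auto simp: sum_distrib_left mult_ac intro!: sum.cong)
  finally show ?thesis .
qed

section \<open>Excited diagram counts as minors\<close>

text \<open>Multilinearity in column \<open>k\<close>; if column \<open>k - 1\<close> is selected as
  well, the extra determinant has two equal columns. The two cases mirror those of the corner
  recursion.\<close>

lemma det_shear:
  fixes A :: "nat \<Rightarrow> int \<Rightarrow> int" and k :: int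
  defines "A' \<equiv> \<lambda>i m. A i m + (if m = k then A i (k - 1) else 0)"
  assumes inj: "inj_on f {..<n}"
  shows "k \<notin> f ` {..<n} \<or> k - 1 \<in> f ` {..<n} \<Longrightarrow>
      det (mat n n (\<lambda>(i, j). A' i (f j))) = det (mat n n (\<lambda>(i, j). A i (f j)))"
    and "j0 < n \<Longrightarrow> f j0 = k \<Longrightarrow> det (mat n n (\<lambda>(i, j). A' i (f j))) =
      det (mat n n (\<lambda>(i, j). A i (f j))) + det (mat n n (\<lambda>(i, j). A i ((f(j0 := k - 1)) j)))"
proof -
  have add: "det (mat n n (\<lambda>(i, j). A' i (f j))) =
      det (mat n n (\<lambda>(i, j). A i (f j))) + det (mat n n (\<lambda>(i, j). A i ((f(j0 := k - 1)) j)))"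
    if j0: "j0 < n" "f j0 = k" for j0
  proof -
    have ne: "f j \<noteq> k" if "j < n" "j \<noteq> j0" for j using inj j0 that by (auto dest: inj_onD)
    have "mat n n (\<lambda>(i, j). A' i (f j)) =
        mat n n (\<lambda>(i, j). if j = j0 then A i k + A i (k - 1) else A i (f j))"
      by (rule eq_matI) (use j0 ne in \<open>auto simp: A'_def\<close>)
    moreover have "mat n n (\<lambda>(i, j). A i (f j)) = mat n n (\<lambda>(i, j). if j = j0 then A i k else A i (f j))"
      by (rule eq_matI) (use j0 in auto)
    moreover have "mat n n (\<lambda>(i, j). A i ((f(j0 := k - 1)) j)) =
        mat n n (\<lambda>(i, j). if j = j0 then A i (k - 1) else A i (f j))"
      by (rule eq_matI) auto
    ultimately show ?thesis using det_column_add[OF j0(1)] by simp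
  qed
  then show "j0 < n \<Longrightarrow> f j0 = k \<Longrightarrow> det (mat n n (\<lambda>(i, j). A' i (f j))) =
      det (mat n n (\<lambda>(i, j). A i (f j))) + det (mat n n (\<lambda>(i, j). A i ((f(j0 := k - 1)) j)))" .
  assume k: "k \<notin> f ` {..<n} \<or> k - 1 \<in> f ` {..<n}"
  show "det (mat n n (\<lambda>(i, j). A' i (f j))) = det (mat n n (\<lambda>(i, j). A i (f j)))"
  proof (cases "k \<in> f ` {..<n}")
    case True
    then obtain j0 where j0: "j0 < n" "f j0 = k" by auto
    obtain j1 where j1: "j1 < n" "f j1 = k - 1" using k True by auto
    have "j1 \<noteq> j0" using j0 j1 by auto
    then have "det (mat n n (\<lambda>(i, j). A i ((f(j0 := k - 1)) j))) = 0"
      using j0 j1 by (intro det_columns_eq[of j0 n j1]) auto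
    then show ?thesis using add[OF j0] by simp
  next
    case False
    then have "mat n n (\<lambda>(i, j). A' i (f j)) = mat n n (\<lambda>(i, j). A i (f j))"
      by (intro eq_matI) (auto simp: A'_def)
    then show ?thesis by simp
  qed
qed

lemma det_permutation_columns:
  assumes inj: "inj_on f {..<n}" and im: "f ` {..<n} = {- int n..<0}"
  shows "det (mat n n (\<lambda>(i, j). if f j = int i - int n then 1 else 0)) = inv_sign n f"
proof -
  define \<pi> where "\<pi> j = (if j < n then nat (f j + int n) else j)" for j
  have f: "f j = int (\<pi> j) - int n" "\<pi> j < n" if "j < n" for j
  proof -
    have "f j \<in> {- int n..<0}" using im that by blast
    then show "f j = int (\<pi> j) - int n" "\<pi> j < n" using that by (auto simp: \<pi>_def)
  qed
  have "bij_betw \<pi> {..<n} {..<n}"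
  proof (rule bij_betwI')
    fix x y assume "x \<in> {..<n}" "y \<in> {..<n}"
    then show "\<pi> x = \<pi> y \<longleftrightarrow> x = y" using f[of x] f[of y] inj_onD[OF inj, of x y] by auto
  next
    fix y assume "y \<in> {..<n}"
    then have "int y - int n \<in> f ` {..<n}" unfolding im by auto
    then obtain x where "x < n" "f x = int y - int n" by auto
    then show "\<exists>x\<in>{..<n}. y = \<pi> x" using f(1)[of x] by auto
  qed (use f in auto)
  then have perm: "\<pi> permutes {..<n}" by (rule bij_imp_permutes) (simp add: \<pi>_def)
  have "mat n n (\<lambda>(i, j). if f j = int i - int n then 1 else (0::int)) =
      transpose_mat (mat n n (\<lambda>(i, j). 1\<^sub>m n $$ (\<pi> i, j)))"
    by (rule eq_matI) (use f in auto)
  then have "det (mat n n (\<lambda>(i, j). if f j = int i - int n then 1 else (0::int))) =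
      det (mat n n (\<lambda>(i, j). 1\<^sub>m n $$ (\<pi> i, j)) :: int mat)"
    by (simp add: det_transpose[of _ n])
  also have "\<dots> = sign \<pi>"
    using det_permute_rows[of "1\<^sub>m n :: int mat" n \<pi>] perm by (simp add: atLeast0LessThan)
  also have "\<dots> = inv_sign n (\<lambda>i. int (\<pi> i))" using inv_sign_permutes[OF perm] by simp
  also have "\<dots> = inv_sign n f"
    unfolding inv_sign_def by (rule prod.cong) (use f in auto)
  finally show ?thesis .
qed

text \<open>The matrix is chosen before \<open>M\<close>, because the recursion for one inner shape
  refers to another. For the empty diagram row \<open>i\<close> is the unit vector at position
  \<open>i - n\<close>; every added corner then shears the columns.\<close>

lemma excited_count_minors:
  assumes "young L" "{..< - int n} \<subseteq> maya L"
  shows "\<exists>A :: nat \<Rightarrow> int \<Rightarrow> int. \<forall>M f. young M \<longrightarrow> {..< - int n} \<subseteq> maya M \<longrightarrow> inj_on f {..<n} \<longrightarrow>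
     f ` {..<n} = maya M - {..< - int n} \<longrightarrow>
     det (mat n n (\<lambda>(i, j). A i (f j))) = inv_sign n f * int (excited_count L M)"
  using assms
proof (induction L rule: young_induct)
  case empty
  let ?A = "\<lambda>(i::nat) m. if m = int i - int n then 1 else (0::int)"
  have "det (mat n n (\<lambda>(i, j). ?A i (f j))) = inv_sign n f * int (excited_count {} M)"
    if M: "young M" "{..< - int n} \<subseteq> maya M" and inj: "inj_on f {..<n}"
      and im: "f ` {..<n} = maya M - {..< - int n}" for M f
  proof (cases "M = {}")
    case True
    have "f ` {..<n} = {- int n..<0}" using im True by (auto simp: maya_empty)
    then show ?thesis using det_permutation_columns[OF inj] True excited_count_self[of "{}"] by simp
  next
    case False
    \<comment> \<open>A nonempty diagram has a particle at some position \<ge> 0, where the matrix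
      has a zero column.\<close>
    have "\<exists>j<n. 0 \<le> f j"
    proof (rule ccontr)
      assume neg: "\<not> (\<exists>j<n. 0 \<le> f j)"
      have "f j \<in> {- int n..<0}" if "j < n" for j
      proof -
        have "f j \<in> maya M - {..< - int n}" using im that by blast
        then show ?thesis using neg that by auto
      qed
      then have "f ` {..<n} \<subseteq> {- int n..<0}" by auto
      moreover have "card (f ` {..<n}) = card {- int n..<0}" using card_image[OF inj] by simp
      ultimately have "f ` {..<n} = {- int n..<0}" by (intro card_subset_eq) auto
      then have "maya M - {..< - int n} = {- int n..<0}" using im by simp
      then have "maya M = {..< - int n} \<union> {- int n..<0}" using M(2) by blast
      also have "\<dots> = {..<0}" by auto
      finally show False using maya_inject[OF M(1) young_empty] False by (simp add: maya_empty)
    qed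
    then obtain j where "j < n" "0 \<le> f j" by blast
    then have "det (mat n n (\<lambda>(i, j). ?A i (f j))) = 0" by (intro det_column_0[of j]) auto
    then show ?thesis using False by (simp add: excited_count_def)
  qed
  then show ?case by (intro exI[of _ ?A]) blast
next
  case (insert a b L)
  let ?k = "content (a, b)"
  let ?L = "insert (a, b) L"
  note mx = maya_insert[OF insert.hyps(1-3)]
  \<comment> \<open>The hop stays inside the window: its origin \<open>?k - 1\<close> is vacant
    afterwards, while all positions below \<open>- n\<close> are occupied.\<close>
  have k: "- int n \<le> ?k - 1"
  proof (rule ccontr)
    assume "\<not> - int n \<le> ?k - 1"
    then have "?k - 1 \<in> maya ?L" using insert.prems by auto
    then show False using mx by auto
  qed
  have "{..< - int n} \<subseteq> maya L" using insert.prems mx k by auto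
  then obtain A :: "nat \<Rightarrow> int \<Rightarrow> int" where A: "\<And>M f. young M \<Longrightarrow> {..< - int n} \<subseteq> maya M \<Longrightarrow>
      inj_on f {..<n} \<Longrightarrow> f ` {..<n} = maya M - {..< - int n} \<Longrightarrow>
      det (mat n n (\<lambda>(i, j). A i (f j))) = inv_sign n f * int (excited_count L M)"
    using insert.IH by blast
  define A' where "A' = (\<lambda>i m. A i m + (if m = ?k then A i (?k - 1) else 0))"
  have LL: "?L - {(a, b)} = L" using insert.hyps(2) by auto
  have corner: "young ?L" "(a, b) \<in> ?L" "young (?L - {(a, b)})"
    unfolding LL using insert.hyps by auto
  have "det (mat n n (\<lambda>(i, j). A' i (f j))) = inv_sign n f * int (excited_count ?L M)"
    if M: "young M" "{..< - int n} \<subseteq> maya M" and inj: "inj_on f {..<n}"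
      and im: "f ` {..<n} = maya M - {..< - int n}" for M f
  proof (cases "?k \<in> maya M \<and> ?k - 1 \<notin> maya M")
    case True
    then obtain y where y: "y \<in> M" "content y = ?k" "young (M - {y})"
      using removable_corner[OF M(1), of ?k] by blast
    have my: "maya (M - {y}) = insert (?k - 1) (maya M - {?k})"
      using maya_remove(1)[OF M(1) y(1,3)] y(2) by simp
    have "?k \<in> f ` {..<n}" using im True k by auto
    then obtain j0 where j0: "j0 < n" "f j0 = ?k" by auto
    let ?f = "f(j0 := ?k - 1)"
    have nk: "?k - 1 \<notin> f ` {..<n}" using im True by auto
    have inj': "inj_on ?f {..<n}" by (rule inj_on_fun_updI[OF inj nk])
    have ne: "f j \<noteq> ?k - 1 \<and> f j \<noteq> ?k" if "j < n" "j \<noteq> j0" for j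
      using inj_onD[OF inj, of j j0] j0 that nk by force
    have "?f ` {..<n} = insert (?k - 1) (f ` {..<n} - {?k})"
      using j0 ne by (auto simp: image_iff)
    also have "\<dots> = maya (M - {y}) - {..< - int n}" unfolding im my using k by auto
    finally have im': "?f ` {..<n} = maya (M - {y}) - {..< - int n}" .
    have sub': "{..< - int n} \<subseteq> maya (M - {y})" unfolding my using M(2) k by auto
    have "det (mat n n (\<lambda>(i, j). A' i (f j))) =
        det (mat n n (\<lambda>(i, j). A i (f j))) + det (mat n n (\<lambda>(i, j). A i (?f j)))"
      unfolding A'_def by (rule det_shear(2)[OF inj j0])
    also have "det (mat n n (\<lambda>(i, j). A i (f j))) = inv_sign n f * int (excited_count L M)"
      by (rule A[OF M inj im])
    also have "det (mat n n (\<lambda>(i, j). A i (?f j))) = inv_sign n ?f * int (excited_count L (M - {y}))"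
      by (rule A[OF y(3) sub' inj' im'])
    also have "inv_sign n ?f = inv_sign n f" by (rule inv_sign_neighbour[of j0 n f, OF j0 ne])
    finally show ?thesis
      using excited_count_rec_corner[OF corner M(1) y(1,3,2)] LL by (simp add: algebra_simps)
  next
    case False
    then have "?k \<notin> f ` {..<n} \<or> ?k - 1 \<in> f ` {..<n}" using im k by auto
    then have "det (mat n n (\<lambda>(i, j). A' i (f j))) = det (mat n n (\<lambda>(i, j). A i (f j)))"
      unfolding A'_def by (rule det_shear(1)[OF inj])
    also have "\<dots> = inv_sign n f * int (excited_count L M)" by (rule A[OF M inj im])
    also have "excited_count L M = excited_count ?L M"
      using excited_count_rec_stuck[OF corner M(1)] False LL by auto
    finally show ?thesis .
  qed
  then show ?case by (intro exI[of _ A']) blast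
qed

text \<open>Pairs avoiding \<open>a\<close> contribute the square of a sign. For a pair with
  \<open>a\<close> as its larger index both factors change sign, so the orientation does not
  matter.\<close>

lemma inv_sign_update:
  assumes inj: "inj_on b {..<n}" and a: "a < n"
  shows "inv_sign n b * inv_sign n (b(a := x)) =
    (\<Prod>j\<in>{..<n} - {a}. sgn (b j - b a) * sgn (b j - x))"
proof -
  let ?P = "{(i, j). i < j \<and> j < n}"
  let ?h = "b(a := x)"
  let ?g = "\<lambda>(i, j). sgn (b j - b i) * sgn (?h j - ?h i)"
  have "inv_sign n b * inv_sign n ?h = (\<Prod>y\<in>?P. ?g y)"
    unfolding inv_sign_def prod.distrib[symmetric] by (rule prod.cong) auto
  also have "\<dots> = (\<Prod>y\<in>{(i, j) \<in> ?P. i = a \<or> j = a}. ?g y)"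
  proof (rule prod.mono_neutral_right[OF finite_pairs])
    show "\<forall>y\<in>?P - {(i, j) \<in> ?P. i = a \<or> j = a}. ?g y = 1"
    proof
      fix y assume "y \<in> ?P - {(i, j) \<in> ?P. i = a \<or> j = a}"
      then obtain i j where y: "y = (i, j)" "i < j" "j < n" "i \<noteq> a" "j \<noteq> a" by auto
      then have "b i \<noteq> b j" using inj_onD[OF inj, of i j] by auto
      then show "?g y = 1" using y by (auto simp: sgn_if)
    qed
  qed auto
  also have "\<dots> = (\<Prod>j\<in>{..<n} - {a}. sgn (b j - b a) * sgn (b j - x))"
  proof (rule prod.reindex_bij_witness[of _ "\<lambda>j. (min a j, max a j)" "\<lambda>(i, j). if i = a then j else i"])
    fix y assume "y \<in> {(i, j) \<in> ?P. i = a \<or> j = a}"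
    then obtain i j where y: "y = (i, j)" "i < j" "j < n" "i = a \<or> j = a" by auto
    have anti: "sgn (s - t) = - sgn (t - s)" for s t :: int by (simp add: sgn_if)
    show "sgn (b (case y of (i, j) \<Rightarrow> if i = a then j else i) - b a) *
        sgn (b (case y of (i, j) \<Rightarrow> if i = a then j else i) - x) = ?g y"
    proof (cases "i = a")
      case True
      then show ?thesis using y(1,2) by simp
    next
      case False
      then show ?thesis using y(1,2,4) anti[of "b a" "b i"] anti[of x "b i"] by simp
    qed
  qed (use a in \<open>auto simp: min_def max_def split: if_splits\<close>)
  finally show ?thesis .
qed

text \<open>Each Cramer entry carries the sign \<open>u a * v c * sgn (b a - f c)\<close>. By
  \<open>zero\<close> the last factor is 1 wherever \<open>E a c\<close> is nonzero, so the signs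
  can be pulled out of the rows and columns. Their product must then equal the sign change of the
  whole exchange, which is where \<open>nc\<close> enters.\<close>

lemma noncrossing_minor:
  fixes A :: "nat \<Rightarrow> int \<Rightarrow> int" and b f :: "nat \<Rightarrow> int"
  assumes K: "K \<le> n" and inj_b: "inj_on b {..<n}" and inj_f: "inj_on f {..<n}"
    and same: "\<And>j. K \<le> j \<Longrightarrow> j < n \<Longrightarrow> f j = b j"
    and new: "\<And>a j. a < K \<Longrightarrow> j < n \<Longrightarrow> f a \<noteq> b j"
    and less: "\<And>a. a < K \<Longrightarrow> f a < b a"
    and nc: "\<And>a c. a < K \<Longrightarrow> c < K \<Longrightarrow> a \<noteq> c \<Longrightarrow>
      b a < f c \<or> b c < f a \<or> f a < f c \<and> b c < b a \<or> f c < f a \<and> b a < b c"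
    and det_b: "det (mat n n (\<lambda>(i, j). A i (b j))) = inv_sign n b"
    and det_h: "\<And>a c. a < K \<Longrightarrow> c < K \<Longrightarrow>
      det (mat n n (\<lambda>(i, j). A i ((b(a := f c)) j))) = inv_sign n (b(a := f c)) * E a c"
    and zero: "\<And>a c. a < K \<Longrightarrow> c < K \<Longrightarrow> b a < f c \<Longrightarrow> E a c = 0"
  shows "det (mat n n (\<lambda>(i, j). A i (f j))) = inv_sign n f * det (mat K K (\<lambda>(a, c). E a c))"
proof -
  define u where "u a = (\<Prod>j\<in>{..<n} - {a}. sgn (b j - b a))" for a
  define v where "v c = (\<Prod>j<n. sgn (b j - f c))" for c
  define g where "g m j = (if j < m then f j else b j)" for m j
  let ?P = "mat n n (\<lambda>(i, j). A i (b j))" and ?Q = "mat n n (\<lambda>(i, j). A i (f j))"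
  have sq: "inv_sign n b * inv_sign n b = 1" by (rule inv_sign_square[OF inj_b])
  \<comment> \<open>The product \<open>v c\<close> includes the index \<open>a\<close>, which the
    formula for a single exchange omits; the extra factor \<open>sgn (b a - f c)\<close>
    compensates, its square being 1.\<close>
  have uv: "inv_sign n b * inv_sign n (b(a := f c)) = u a * v c * sgn (b a - f c)"
    if "a < K" "c < K" for a c
  proof -
    have a: "a < n" using that K by simp
    have "sgn (b a - f c) * sgn (b a - f c) = 1" using new[OF that(2) a] by (auto simp: sgn_if)
    moreover have "v c = sgn (b a - f c) * (\<Prod>j\<in>{..<n} - {a}. sgn (b j - f c))"
      unfolding v_def by (rule prod.remove) (use a in auto)
    ultimately show ?thesis
      unfolding inv_sign_update[OF inj_b a] by (simp add: u_def prod.distrib)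
  qed
  have entry: "det ?P * det (replace_col ?P (col ?Q c) a) = u a * v c * E a c"
    if "a < K" "c < K" for a c
  proof -
    have "replace_col ?P (col ?Q c) a = mat n n (\<lambda>(i, j). A i ((b(a := f c)) j))"
      by (rule eq_matI) (use that K in \<open>auto simp: replace_col_def\<close>)
    then have "det ?P * det (replace_col ?P (col ?Q c) a) =
        inv_sign n b * inv_sign n (b(a := f c)) * E a c"
      using det_b det_h[OF that] by simp
    also have "\<dots> = u a * v c * E a c"
      unfolding uv[OF that] using zero[OF that] new[OF that(2), of a] that K by (auto simp: sgn_if)
    finally show ?thesis .
  qed
  have "det ?Q = det ?P * det (mat K K (\<lambda>(a, c). det ?P * det (replace_col ?P (col ?Q c) a)))"
    by (rule det_replace_columns[of _ n]) (use K same sq det_b in \<open>auto intro!: eq_vecI\<close>)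
  also have "mat K K (\<lambda>(a, c). det ?P * det (replace_col ?P (col ?Q c) a)) =
      mat K K (\<lambda>(a, c). u a * v c * E a c)"
    by (rule eq_matI) (use entry in auto)
  also have "det \<dots> = (\<Prod>a<K. u a * v a) * det (mat K K (\<lambda>(a, c). E a c))"
    by (simp add: det_scale_rows_cols prod.distrib)
  also have "(\<Prod>a<K. u a * v a) = inv_sign n b * inv_sign n f"
  proof -
    have inj_g: "inj_on (g m) {..<n}" if "m \<le> K" for m
    proof (rule inj_onI)
      fix i j assume ij: "i \<in> {..<n}" "j \<in> {..<n}" "g m i = g m j"
      then show "i = j"
        using inj_onD[OF inj_b, of i j] inj_onD[OF inj_f, of i j] new[of i j] new[of j i] that
        by (auto simp: g_def split: if_splits)
    qed
    \<comment> \<open>Exchange the columns one at a time: as the pairs \<open>(f j, b j)\<close> and \<open>(f m, b m)\<close> do not cross,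
      \<open>f j\<close> lies between \<open>f m\<close> and \<open>b m\<close> if and only if \<open>b j\<close> does.\<close>
    have step: "u m * v m = inv_sign n (g m) * inv_sign n (g (Suc m))" if m: "m < K" for m
    proof -
      have mn: "m < n" using m K by simp
      have "g (Suc m) = (g m)(m := f m)" by (auto simp: g_def)
      then have "inv_sign n (g m) * inv_sign n (g (Suc m)) =
          (\<Prod>j\<in>{..<n} - {m}. sgn (g m j - g m m) * sgn (g m j - f m))"
        using inv_sign_update[OF inj_g mn, of m] m by simp
      also have "\<dots> = (\<Prod>j\<in>{..<n} - {m}. sgn (b j - b m) * sgn (b j - f m))"
      proof (rule prod.cong[OF refl])
        fix j assume j: "j \<in> {..<n} - {m}"
        show "sgn (g m j - g m m) * sgn (g m j - f m) = sgn (b j - b m) * sgn (b j - f m)"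
        proof (cases "j < m")
          case True
          then show ?thesis
            using nc[of j m] less[of j] less[of m] m by (auto simp: g_def sgn_if)
        next
          case False
          then show ?thesis by (simp add: g_def)
        qed
      qed
      also have "\<dots> = u m * (\<Prod>j\<in>{..<n} - {m}. sgn (b j - f m))"
        by (simp add: u_def prod.distrib)
      \<comment> \<open>The factor still missing is \<open>sgn (b m - f m) = 1\<close>.\<close>
      also have "(\<Prod>j\<in>{..<n} - {m}. sgn (b j - f m)) = v m"
        unfolding v_def using less[OF m] mn by (subst prod.remove[of "{..<n}" m]) auto
      finally show ?thesis by simp
    qed
    have "m \<le> K \<Longrightarrow> (\<Prod>a<m. u a * v a) = inv_sign n b * inv_sign n (g m)" for m
    proof (induction m)
      case 0
      have "g 0 = b" by (auto simp: g_def)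
      then show ?case using sq by simp
    next
      case (Suc m)
      have "(\<Prod>a<Suc m. u a * v a) =
          inv_sign n b * (inv_sign n (g m) * inv_sign n (g m)) * inv_sign n (g (Suc m))"
        using Suc step[of m] by (simp add: mult_ac)
      then show ?case using inv_sign_square[OF inj_g, of m] Suc.prems by simp
    qed
    then have "(\<Prod>a<K. u a * v a) = inv_sign n b * inv_sign n (g K)" by simp
    also have "inv_sign n (g K) = inv_sign n f"
      by (rule inv_sign_cong) (use same in \<open>auto simp: g_def\<close>)
    finally show ?thesis .
  qed
  finally show ?thesis using sq det_b by (simp add: mult.assoc[symmetric])
qed

section \<open>The determinant formula\<close>

lemma maya_below:
  assumes "young L"
  shows "\<exists>N. \<forall>n\<ge>N. {..< - int n} \<subseteq> maya L"
proof -
  obtain N where N: "\<And>k. N \<le> \<bar>k\<bar> \<Longrightarrow> diag_len L k = 0" "0 \<le> N"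
    using diag_len_eventually_0 young_finite assms by metis
  have "k \<in> maya L" if "nat N \<le> n" "k < - int n" for n k
  proof -
    have "N \<le> \<bar>k\<bar>" "N \<le> \<bar>k + 1\<bar>" "k < 0" using that N(2) by auto
    then show ?thesis using N(1)[of k] N(1)[of "k + 1"] by (simp add: maya_def)
  qed
  then show ?thesis by (intro exI[of _ "nat N"]) auto
qed

text \<open>Serves both shapes: the exchanged columns come first and the common ones follow in the
  same order \<open>e\<close>, so the two enumerations agree from \<open>K\<close> on.\<close>

lemma extend_enumeration:
  fixes K n :: nat
  assumes K: "K \<le> n" and g: "inj_on g {..<K}" and e: "bij_betw e {..<n - K} C"
    and disj: "g ` {..<K} \<inter> C = {}"
  defines "h \<equiv> \<lambda>j. if j < K then g j else e (j - K)"
  shows "inj_on h {..<n}" "h ` {..<n} = g ` {..<K} \<union> C"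
proof -
  have eC: "e (j - K) \<in> C" if "K \<le> j" "j < n" for j
  proof -
    have "j - K < n - K" by (rule diff_less_mono[OF that(2,1)])
    then show ?thesis using bij_betwE[OF e] by simp
  qed
  have einj: "inj_on e {..<n - K}" using e by (simp add: bij_betw_def)
  show "inj_on h {..<n}"
  proof (rule inj_onI)
    fix i j assume ij: "i \<in> {..<n}" "j \<in> {..<n}" "h i = h j"
    show "i = j"
    proof (cases "i < K"; cases "j < K")
      assume "i < K" "j < K"
      then show ?thesis using ij inj_onD[OF g, of i j] by (simp add: h_def)
    next
      assume "i < K" "\<not> j < K"
      then show ?thesis using ij eC[of j] disj by (auto simp: h_def)
    next
      assume "\<not> i < K" "j < K"
      then show ?thesis using ij eC[of i] disj by (auto simp: h_def)
    next
      assume *: "\<not> i < K" "\<not> j < K"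
      have "i - K = j - K" by (rule inj_onD[OF einj]) (use * ij in \<open>auto simp: h_def\<close>)
      then show ?thesis using * by simp
    qed
  qed
  show "h ` {..<n} = g ` {..<K} \<union> C"
  proof (intro equalityI subsetI)
    fix x assume "x \<in> h ` {..<n}"
    then show "x \<in> g ` {..<K} \<union> C" using eC by (auto simp: h_def)
  next
    fix x assume "x \<in> g ` {..<K} \<union> C"
    then show "x \<in> h ` {..<n}"
    proof
      assume "x \<in> g ` {..<K}"
      then show ?thesis using K by (auto simp: h_def image_iff)
    next
      assume "x \<in> C"
      then obtain i where "i < n - K" "x = e i" using e by (auto simp: bij_betw_def)
      then show ?thesis by (intro image_eqI[of _ _ "i + K"]) (auto simp: h_def)
    qed
  qed
qed

theorem theorem3p4:
  fixes lam mu :: "nat list" and \<theta>s :: "cell set list"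
  assumes "is_partition lam" and "is_partition mu"
    and "diagram mu \<subseteq> diagram lam"
    and "cells_connected (diagram lam - diagram mu)"
    and "lascoux_pragacz lam mu \<theta>s"
  shows "int (num_excited lam mu) =
    det (mat (length \<theta>s) (length \<theta>s)
      (\<lambda>(i, j). int (substrip_excited (hash_strip (\<theta>s ! 0) (\<theta>s ! i) (\<theta>s ! j)))))"
proof -
  define L where "L = diagram lam"
  define M where "M = diagram mu"
  have yL: "young L" and yM: "young M" and sub_ML: "M \<subseteq> L"
    using young_diagram assms(1-3) by (auto simp: L_def M_def)
  interpret skew_shape lam L M
    by unfold_locales (use yL yM sub_ML in \<open>auto simp: L_def\<close>)
  define K where "K = length \<theta>s"
  define p where "p a = start_content (\<theta>s ! a)" for a
  define q where "q a = end_content (\<theta>s ! a)" for a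
  define E where "E a c = int (substrip_excited (hash_strip (\<theta>s ! 0) (\<theta>s ! a) (\<theta>s ! c)))" for a c
  have set: "set \<theta>s = (\<Union>t. components (layer t))" and dist: "distinct \<theta>s"
    and sorted: "sorted_wrt (\<lambda>\<theta> \<theta>'. end_content \<theta> \<ge> end_content \<theta>') \<theta>s"
    using assms(5) unfolding lascoux_pragacz_def layer_def M_def[symmetric] by blast+
  have strip: "\<exists>t. lp_interval t (p a) (q a) \<and> \<theta>s ! a = layer_cell t ` {p a..q a}" if "a < K" for a
  proof -
    have "\<theta>s ! a \<in> set \<theta>s" using that by (simp add: K_def)
    then obtain t p' q' where "lp_interval t p' q'" "\<theta>s ! a = layer_cell t ` {p'..q'}"
      unfolding set components_layer by blast
    then show ?thesis using strip_contents[of t p' q'] by (auto simp: p_def q_def)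
  qed
  have index: "\<exists>a<K. \<theta>s ! a = layer_cell t ` {p'..q'} \<and> p a = p' \<and> q a = q'"
    if "lp_interval t p' q'" for t p' q'
  proof -
    have "layer_cell t ` {p'..q'} \<in> set \<theta>s" unfolding set components_layer using that by blast
    then show ?thesis using strip_contents[OF that] by (auto simp: in_set_conv_nth K_def p_def q_def)
  qed
  have eq_index: "a = c" if "a < K" "c < K" "\<theta>s ! a = \<theta>s ! c" for a c
    using that dist by (simp add: nth_eq_iff_index_eq K_def)
  have inj_p: "inj_on (\<lambda>a. p a - 1) {..<K}"
  proof (rule inj_onI)
    fix a c assume ac: "a \<in> {..<K}" "c \<in> {..<K}" "p a - 1 = p c - 1"
    obtain t t' where "lp_interval t (p a) (q a)" "\<theta>s ! a = layer_cell t ` {p a..q a}"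
        "lp_interval t' (p c) (q c)" "\<theta>s ! c = layer_cell t' ` {p c..q c}"
      using strip[of a] strip[of c] ac by auto
    then show "a = c" using lp_interval_unique_start[of t "p a" "q a" t' "q c"] ac eq_index by auto
  qed
  have inj_q: "inj_on q {..<K}"
  proof (rule inj_onI)
    fix a c assume ac: "a \<in> {..<K}" "c \<in> {..<K}" "q a = q c"
    obtain t t' where "lp_interval t (p a) (q a)" "\<theta>s ! a = layer_cell t ` {p a..q a}"
        "lp_interval t' (p c) (q c)" "\<theta>s ! c = layer_cell t' ` {p c..q c}"
      using strip[of a] strip[of c] ac by auto
    then show "a = c" using lp_interval_unique_end[of t "p a" "q a" t' "p c"] ac eq_index by auto
  qed
  have im_p: "(\<lambda>a. p a - 1) ` {..<K} = maya M - maya L"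
  proof (intro equalityI subsetI)
    fix x assume "x \<in> (\<lambda>a. p a - 1) ` {..<K}"
    then obtain a where "a < K" "x = p a - 1" by auto
    then show "x \<in> maya M - maya L" using strip[of a] lp_interval_maya(3) by blast
  next
    fix x assume "x \<in> maya M - maya L"
    then obtain t q' where "lp_interval t (x + 1) q'" by (rule lp_interval_start)
    then obtain a where "a < K" "p a = x + 1" using index by blast
    then show "x \<in> (\<lambda>a. p a - 1) ` {..<K}" by (intro image_eqI[of _ _ a]) auto
  qed
  have im_q: "q ` {..<K} = maya L - maya M"
  proof (intro equalityI subsetI)
    fix x assume "x \<in> q ` {..<K}"
    then obtain a where "a < K" "x = q a" by auto
    then show "x \<in> maya L - maya M" using strip[of a] lp_interval_maya(4) by blast
  next
    fix x assume "x \<in> maya L - maya M"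
    then obtain t p' where "lp_interval t p' x" by (rule lp_interval_end)
    then obtain a where "a < K" "q a = x" using index by blast
    then show "x \<in> q ` {..<K}" by blast
  qed
  have pq: "p a \<le> q a" if "a < K" for a using strip[OF that] by (auto simp: lp_interval_def)
  have nc: "q a < p c - 1 \<or> q c < p a - 1 \<or> p a - 1 < p c - 1 \<and> q c < q a \<or> p c - 1 < p a - 1 \<and> q a < q c"
    if ac: "a < K" "c < K" "a \<noteq> c" for a c
  proof -
    obtain t t' where t: "lp_interval t (p a) (q a)" "lp_interval t' (p c) (q c)"
      using strip[OF ac(1)] strip[OF ac(2)] by blast
    have "p a \<noteq> p c" "q a \<noteq> q c"
      using inj_onD[OF inj_p, of a c] inj_onD[OF inj_q, of a c] ac by auto
    then show ?thesis
      using lp_interval_trichotomy[OF t] lp_interval_trichotomy[OF t(2,1)] by linarith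
  qed
  have sub0: "layer_contents t \<subseteq> layer_contents 0" for t by (auto simp: layer_contents_def)
  have pq0: "p a \<in> layer_contents 0" "q a \<in> layer_contents 0" if "a < K" for a
    using strip[OF that] sub0 by (force simp: lp_interval_def)+
  have conn: "{k..k'} \<subseteq> layer_contents 0" if "k \<in> layer_contents 0" "k' \<in> layer_contents 0" for k k'
    using layer_contents_interval that assms(4) by (simp add: L_def M_def)
  \<comment> \<open>Connectedness makes the outermost layer one interval, whose right end bounds all
    ending contents; the ordering of the strips then puts it first.\<close>
  have tau: "\<theta>s ! 0 = layer_cell 0 ` layer_contents 0" if K0: "0 < K"
  proof -
    obtain P Q where PQ: "lp_interval 0 P Q" "P \<le> p 0" "p 0 \<le> Q"
      using lp_interval_exists[OF pq0(1)[OF K0]] by blast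
    have all: "layer_contents 0 = {P..Q}"
    proof (intro equalityI subsetI)
      fix k assume k: "k \<in> layer_contents 0"
      have PQ0: "P \<in> layer_contents 0" "Q \<in> layer_contents 0" using PQ by (auto simp: lp_interval_def)
      have "\<not> k < P"
      proof
        assume "k < P"
        then have "P - 1 \<in> {k..P}" by auto
        then show False using conn[OF k PQ0(1)] PQ(1) unfolding lp_interval_def by blast
      qed
      moreover have "\<not> Q < k"
      proof
        assume "Q < k"
        then have "Q + 1 \<in> {Q..k}" by auto
        then show False using conn[OF PQ0(2) k] PQ(1) unfolding lp_interval_def by blast
      qed
      ultimately show "k \<in> {P..Q}" by simp
    qed (use PQ(1) in \<open>auto simp: lp_interval_def\<close>)
    obtain a where a: "a < K" "\<theta>s ! a = layer_cell 0 ` {P..Q}" "q a = Q" using index[OF PQ(1)] by blast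
    have "q 0 \<le> Q" using pq0(2)[OF K0] all by auto
    moreover have "q a \<le> q 0"
    proof (cases "a = 0")
      case False
      then show ?thesis using sorted a(1) by (auto simp: sorted_wrt_iff_nth_less q_def K_def)
    qed simp
    ultimately have "a = 0" using inj_onD[OF inj_q, of a 0] a K0 by auto
    then show ?thesis using a(2) all by simp
  qed
  have E: "E a c = (if p c \<le> q a then int (strip_excited {x \<in> outer_strip L. p c - 1 < content x \<and> content x \<le> q a}) else 0)"
    if ac: "a < K" "c < K" for a c
  proof (cases "p c \<le> q a")
    case True
    have "{x \<in> \<theta>s ! 0. p c \<le> content x \<and> content x \<le> q a} =
        {x \<in> outer_strip L. p c - 1 < content x \<and> content x \<le> q a}" (is "?X = ?Y")
    proof (intro equalityI subsetI)
      fix x assume x: "x \<in> ?X"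
      then have "x \<in> layer 0" using tau ac by (auto simp: layer_eq)
      then show "x \<in> ?Y" using x by (auto simp: layer_def simp flip: L_def)
    next
      fix x assume x: "x \<in> ?Y"
      obtain s where s: "x = diag_cell (content x) s" using diag_cell_cases by blast
      have "s = diag_len L (content x)" using x s outer_strip_iff[OF yL, of "content x" s] by auto
      then have "x = layer_cell 0 (content x)" using s by (simp add: layer_cell_def)
      \<comment> \<open>The outer strip of \<open>L\<close> may meet \<open>M\<close>, but not
        between \<open>p c\<close> and \<open>q a\<close>, where connectedness keeps the depth
        positive.\<close>
      moreover have "content x \<in> layer_contents 0"
        using x conn[OF pq0(1)[OF ac(2)] pq0(2)[OF ac(1)]] by auto
      ultimately show "x \<in> ?X" using x tau ac by auto
    qed
    then show ?thesis
      using True by (simp add: E_def hash_strip_def substrip_def substrip_excited_def p_def[symmetric] q_def[symmetric])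
  next
    case False
    \<comment> \<open>An empty substrip would need \<open>p c - 1 = q a\<close>, but these positions
      lie in disjoint sets; so the substrip is undefined here.\<close>
    have "p c - 1 \<in> maya M - maya L" "q a \<in> maya L - maya M" using im_p im_q ac by blast+
    then have "p c \<noteq> q a + 1" by auto
    then show ?thesis
      using False by (simp add: E_def hash_strip_def substrip_def substrip_excited_def p_def[symmetric] q_def[symmetric])
  qed
  obtain n where n: "{..< - int n} \<subseteq> maya L" "{..< - int n} \<subseteq> maya M"
    using maya_below[OF yL] maya_below[OF yM] by (meson nat_le_linear)
  \<comment> \<open>The particles above the cut that both shapes share; their columns stay in
    place.\<close>
  define C where "C = maya L \<inter> maya M - {..< - int n}"
  have splitL: "maya L - {..< - int n} = q ` {..<K} \<union> C"
    unfolding im_q C_def using n(2) by blast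
  have splitM: "maya M - {..< - int n} = (\<lambda>a. p a - 1) ` {..<K} \<union> C"
    unfolding im_p C_def using n(1) by blast
  have disj: "q ` {..<K} \<inter> C = {}" "(\<lambda>a. p a - 1) ` {..<K} \<inter> C = {}"
    unfolding im_p im_q C_def by auto
  have fin: "finite C" using finite_card_maya[OF yL n(1)] unfolding splitL by simp
  have "card (q ` {..<K} \<union> C) = n" using finite_card_maya[OF yL n(1)] unfolding splitL by simp
  then have "K + card C = n"
    using card_Un_disjoint[OF _ fin disj(1)] card_image[OF inj_q] by simp
  then have Kn: "K \<le> n" and cardC: "card C = n - K" by auto
  obtain e where e: "bij_betw e {..<n - K} C"
    using ex_bij_betw_nat_finite[OF fin] cardC by (auto simp: atLeast0LessThan)
  \<comment> \<open>\<open>b\<close> lists the particles of \<open>L\<close> and \<open>f\<close>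
    those of \<open>M\<close>; at each index \<open>a < K\<close> the exchanged pair comes from the
    two ends of one strip.\<close>
  define b where "b = (\<lambda>j. if j < K then q j else e (j - K))"
  define f where "f = (\<lambda>j. if j < K then p j - 1 else e (j - K))"
  have inj_b: "inj_on b {..<n}" and im_b: "b ` {..<n} = maya L - {..< - int n}"
    using extend_enumeration[OF Kn inj_q e disj(1)] splitL unfolding b_def by auto
  have inj_f: "inj_on f {..<n}" and im_f: "f ` {..<n} = maya M - {..< - int n}"
    using extend_enumeration[OF Kn inj_p e disj(2)] splitM unfolding f_def by auto
  have bL: "b j \<in> maya L" if "j < n" for j using im_b that by blast
  have fM: "f a \<in> maya M - maya L" if "a < K" for a using im_p that by (auto simp: f_def)
  have fn: "- int n \<le> f a" if "a < K" for a using fM[OF that] n(1) by (meson DiffD2 lessThan_iff not_le subsetD)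
  have bn: "- int n \<le> b a" if "a < n" for a using im_b that by (metis DiffD2 imageI lessThan_iff not_le)
  have new: "f a \<noteq> b j" if "a < K" "j < n" for a j using fM[OF that(1)] bL[OF that(2)] by auto
  obtain A :: "nat \<Rightarrow> int \<Rightarrow> int" where A: "\<And>N g. young N \<Longrightarrow> {..< - int n} \<subseteq> maya N \<Longrightarrow>
      inj_on g {..<n} \<Longrightarrow> g ` {..<n} = maya N - {..< - int n} \<Longrightarrow>
      det (mat n n (\<lambda>(i, j). A i (g j))) = inv_sign n g * int (excited_count L N)"
    using excited_count_minors[OF yL n(1)] by blast
  have entry: "det (mat n n (\<lambda>(i, j). A i ((b(a := f c)) j))) = inv_sign n (b(a := f c)) * E a c"
    and zero: "b a < f c \<Longrightarrow> E a c = 0"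
    if ac: "a < K" "c < K" for a c
  proof -
    have an: "a < n" using ac Kn by simp
    have r: "b a \<in> maya L" "b a = q a" using bL[OF an] ac by (auto simp: b_def)
    have c: "f c \<notin> maya L" "f c = p c - 1" using fM[OF ac(2)] ac by (auto simp: f_def)
    let ?h = "b(a := f c)"
    have inj_h: "inj_on ?h {..<n}" by (rule inj_on_fun_updI[OF inj_b]) (use new[OF ac(2)] in force)
    have "?h ` {..<n} = insert (f c) (b ` {..<n} - {b a})"
      using an inj_onD[OF inj_b, of _ a] by (auto simp: image_iff)
    then have im_h: "?h ` {..<n} = insert (f c) (maya L - {b a}) - {..< - int n}"
      using im_b fn[OF ac(2)] by auto
    have subN: "{..< - int n} \<subseteq> insert (f c) (maya L - {b a})" using n(1) bn[OF an] by auto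
    \<comment> \<open>Replacing \<open>b a\<close> by \<open>f c\<close> removes a segment of the
      outer strip if \<open>f c < b a\<close>. Otherwise it enlarges \<open>L\<close>, and the count
      is 0, like the entry of the undefined substrip.\<close>
    have "\<exists>N. young N \<and> maya N = insert (f c) (maya L - {b a}) \<and> int (excited_count L N) = E a c"
    proof (cases "f c < b a")
      case True
      then obtain N where N: "young N" "maya N = insert (f c) (maya L - {b a})"
        using maya_move_down[OF yL r(1) c(1)] by blast
      have "p c \<le> q a" using True r c by simp
      then have "int (excited_count L N) = E a c"
        using strip_excited_outer_strip[OF yL r(1) c(1) True N] E[OF ac] r(2) c(2) by simp
      then show ?thesis using N by blast
    next
      case False
      then have gt: "b a < f c" using new[OF ac(2) an] by simp
      then obtain N where N: "young N" "L \<subset> N" "maya N = insert (f c) (maya L - {b a})"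
        using maya_move_up[OF yL r(1) c(1)] by blast
      have "\<not> N \<subseteq> L" using N(2) by blast
      then have "int (excited_count L N) = E a c"
        using E[OF ac] r(2) c(2) gt by (simp add: excited_count_def)
      then show ?thesis using N by blast
    qed
    then obtain N where N: "young N" "maya N = insert (f c) (maya L - {b a})"
      "int (excited_count L N) = E a c" by blast
    show "det (mat n n (\<lambda>(i, j). A i (?h j))) = inv_sign n ?h * E a c"
      using A[OF N(1) _ inj_h] im_h subN N(2,3) by simp
    show "b a < f c \<Longrightarrow> E a c = 0" using E[OF ac] r(2) c(2) by simp
  qed
  have "inv_sign n f * int (excited_count L M) = det (mat n n (\<lambda>(i, j). A i (f j)))"
    using A[OF yM n(2) inj_f im_f] by simp
  also have "\<dots> = inv_sign n f * det (mat K K (\<lambda>(a, c). E a c))"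
  proof (rule noncrossing_minor[OF Kn inj_b inj_f])
    show "f j = b j" if "K \<le> j" "j < n" for j using that by (simp add: f_def b_def)
    show "f a < b a" if "a < K" for a using pq[OF that] that by (simp add: f_def b_def)
    show "b a < f c \<or> b c < f a \<or> f a < f c \<and> b c < b a \<or> f c < f a \<and> b a < b c"
      if "a < K" "c < K" "a \<noteq> c" for a c using nc[OF that] that by (simp add: f_def b_def)
    show "det (mat n n (\<lambda>(i, j). A i (b j))) = inv_sign n b"
      using A[OF yL n(1) inj_b im_b] excited_count_self by simp
  qed (use new entry zero in auto)
  finally have "int (excited_count L M) = det (mat K K (\<lambda>(a, c). E a c))"
    using inv_sign_square[OF inj_f] by (metis mult.assoc mult_1)
  moreover have "num_excited lam mu = excited_count L M"
    using sub_ML by (simp add: num_excited_def excited_diagrams_eq excited_count_def L_def M_def)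
  ultimately show ?thesis by (simp add: E_def K_def)
qed

end
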